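(* Let $E$ be a connected finite graph with disjoint cycles. Then $E$ can be transformed into a graph in normal form through a finite sequence of in-splittings and out-splittings.
   Context: A (directed) graph $E=(E^0,E^1,s,r)$ has a vertex set $E^0$, an edge set $E^1$ (parallel edges and loops allowed), and source and range maps $s,r:E^1\to E^0$; it is finite if $E^0$ and $E^1$ are finite. Graphs are considered up to isomorphism. A path of length $n\ge 1$ is $e_1\cdots e_n$ with $r(e_i)=s(e_{i+1})$. A cycle is a path $e_1\cdots e_n$ ($n\ge1$) with $r(e_n)=s(e_1)$ and $s(e_1),\dots,s(e_n)$ distinct (cycles differing by a cyclic rotation define the same cycle $C$; $C^0$ is its vertex set, $|C|$ its length). A graph with disjoint cycles is a graph in which every vertex is the base of at most one cycle. $\mathcal C_E$ is the set of cycles of $E$ and $\mathcal C_E^0=\bigcup_{C\in\mathcal C_E}C^0$. Trails: a trail is a path $\alpha=e_1\cdots e_n$ ($n\ge 1$), of length $|\alpha|=n$, with $s(e_1),r(e_n)\in\mathcal C_E^0$ and $s(e_i)\notin\mathcal C_E^0$ for $1<i\le n$. It is a trail from $A$ to $B$ if $s(\alpha)\in A^0$ and $r(\alpha)\in B^0$. The interior vertices of $\alpha$ are the vertices on $\alpha$ not in $\mathcal C_E^0$. Quasi-normal form: a connected finite graph with disjoint cycles $C_1,\dots,C_n$ is in quasi-normal form if (1) any two distinct trails have no common interior vertices; and (2) there are distinguished vertices $v_i\in C_i^0$ (the vertices of index $1$; the other vertices of $C_i$ are numbered cyclically following the edges of $C_i$) such that, for all $i\ne j$, every trail from $C_i$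 to $C_j$ starts at $v_i$ and ends at $v_j$. Normal form: a graph in quasi-normal form is in normal form if every pair of cycles $(A,B)$ is good, i.e. for any trails $\alpha,\beta$ from $A$ to $B$: (1) if $|\alpha|\equiv|\beta| \pmod{\gcd(|A|,|B|)}$ then $|\alpha|=|\beta|$; (2) for all $0\le t<\gcd(|A|,|B|)$, if $|\alpha|\equiv t\pmod{\gcd(|A|,|B|)}$ then $|\alpha|\equiv t\pmod{|A||B|}$. In-splitting: for each $v\in E^0$ with $r^{-1}(v)\neq\emptyset$ choose a partition $\{\mathcal E^v_1,\dots,\mathcal E^v_{m(v)}\}$ of $r^{-1}(v)$ into nonempty sets; if $r^{-1}(v)=\emptyset$ put $m(v)=1$, $v_1=v$. The resulting in-splitting $F$ of $E$ has vertices $v_i$ ($v\in E^0$, $1\le i\le m(v)$) and edges $e_j$ ($e\in E^1$, $1\le j\le m(s(e))$), with $s(e_j)=s(e)_j$ and $r(e_j)=r(e)_i$ where $e\in\mathcal E^{r(e)}_i$. An out-splitting of $E$ is a graph $F$ whose transpose (all edges reversed) is an in-splitting of the transpose of $E$. *)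

theory Defs
  imports
    "Graph_Theory.Graph_Theory"
    "HOL-Library.Disjoint_Sets"
    "HOL-Number_Theory.Cong"
begin

text \<open>
  A directed graph is a \<open>pre_digraph\<close>, with \<open>tail\<close> and \<open>head\<close> as the
  source and range maps; parallel edges and loops are allowed.  A path of length at least 1
  is a nonempty arc list \<open>p\<close> with \<open>awalk u p v\<close>.
\<close>

text \<open>
  The library predicate \<open>pre_digraph.cycle\<close> speaks about a closed path
  \<open>e\<^sub>1 \<dots> e\<^sub>n\<close> with a chosen starting point, loops included; the vertices it requires to be
  distinct are the ranges, which for a closed path are the sources up to rotation.
\<close>

definition cycle_at :: "('a,'b) pre_digraph \<Rightarrow> 'a \<Rightarrow> 'b list \<Rightarrow> bool" where
  "cycle_at E v p \<longleftrightarrow> pre_digraph.cycle E p \<and> pre_digraph.awalk E v p v"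

definition disjoint_cycles :: "('a,'b) pre_digraph \<Rightarrow> bool" where
  "disjoint_cycles E \<longleftrightarrow> (\<forall>v p q. cycle_at E v p \<and> cycle_at E v q \<longrightarrow> p = q)"

text \<open>A cycle up to cyclic rotation is represented by the set of all its rotations.\<close>

definition rotations :: "'b list \<Rightarrow> 'b list set" where
  "rotations p = {rotate k p | k. True}"

definition cycles :: "('a,'b) pre_digraph \<Rightarrow> 'b list set set" where
  "cycles E = rotations ` {p. pre_digraph.cycle E p}"

definition cycle_verts :: "('a,'b) pre_digraph \<Rightarrow> 'b list set \<Rightarrow> 'a set" where
  "cycle_verts E C = (\<Union>p\<in>C. tail E ` set p)"

definition cycle_length :: "'b list set \<Rightarrow> nat" where
  "cycle_length C = (THE n. \<forall>p\<in>C. length p = n)"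

definition cyclic_verts :: "('a,'b) pre_digraph \<Rightarrow> 'a set" where
  "cyclic_verts E = (\<Union>C\<in>cycles E. cycle_verts E C)"

text \<open>Not to be confused with \<open>pre_digraph.trail\<close>, a walk without repeated arcs.\<close>

definition cycle_trail :: "('a,'b) pre_digraph \<Rightarrow> 'b list \<Rightarrow> bool" where
  "cycle_trail E p \<longleftrightarrow> p \<noteq> [] \<and>
     (\<exists>u v. pre_digraph.awalk E u p v \<and> u \<in> cyclic_verts E \<and> v \<in> cyclic_verts E) \<and>
     (\<forall>e\<in>set (tl p). tail E e \<notin> cyclic_verts E)"

definition trail_source :: "('a,'b) pre_digraph \<Rightarrow> 'b list \<Rightarrow> 'a" where
  "trail_source E p = tail E (hd p)"

definition trail_range :: "('a,'b) pre_digraph \<Rightarrow> 'b list \<Rightarrow> 'a" where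
  "trail_range E p = head E (last p)"

definition trail_from_to ::
  "('a,'b) pre_digraph \<Rightarrow> 'b list set \<Rightarrow> 'b list \<Rightarrow> 'b list set \<Rightarrow> bool" where
  "trail_from_to E A p B \<longleftrightarrow> cycle_trail E p \<and>
     trail_source E p \<in> cycle_verts E A \<and> trail_range E p \<in> cycle_verts E B"

definition interior_verts :: "('a,'b) pre_digraph \<Rightarrow> 'b list \<Rightarrow> 'a set" where
  "interior_verts E p = (tail E ` set p \<union> head E ` set p) - cyclic_verts E"

text \<open>
  \<open>d C\<close> is the distinguished vertex (index 1) of \<open>C\<close>; the numbering of the other vertices
  is determined by it and does not enter the condition.
\<close>

definition quasi_normal_form :: "('a,'b) pre_digraph \<Rightarrow> bool" where
  "quasi_normal_form E \<longleftrightarrow>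
     fin_digraph E \<and> Digraph_Component.connected E \<and> disjoint_cycles E \<and>
     (\<forall>p q. cycle_trail E p \<and> cycle_trail E q \<and> p \<noteq> q \<longrightarrow>
        interior_verts E p \<inter> interior_verts E q = {}) \<and>
     (\<exists>d. (\<forall>C\<in>cycles E. d C \<in> cycle_verts E C) \<and>
        (\<forall>A\<in>cycles E. \<forall>B\<in>cycles E. A \<noteq> B \<longrightarrow>
           (\<forall>p. trail_from_to E A p B \<longrightarrow> trail_source E p = d A \<and> trail_range E p = d B)))"

definition good_pair :: "('a,'b) pre_digraph \<Rightarrow> 'b list set \<Rightarrow> 'b list set \<Rightarrow> bool" where
  "good_pair E A B \<longleftrightarrow>
     (\<forall>p q. trail_from_to E A p B \<and> trail_from_to E A q B \<longrightarrow>
        ([length p = length q] (mod gcd (cycle_length A) (cycle_length B)) \<longrightarrow>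
           length p = length q) \<and>
        (\<forall>t < gcd (cycle_length A) (cycle_length B).
           [length p = t] (mod gcd (cycle_length A) (cycle_length B)) \<longrightarrow>
           [length p = t] (mod cycle_length A * cycle_length B)))"

definition normal_form :: "('a,'b) pre_digraph \<Rightarrow> bool" where
  "normal_form E \<longleftrightarrow>
     quasi_normal_form E \<and> (\<forall>A\<in>cycles E. \<forall>B\<in>cycles E. good_pair E A B)"

text \<open>
  \<open>P v 1, \<dots>, P v (m v)\<close> are the blocks of the chosen partition of the arcs into \<open>v\<close>;
  \<open>partition_on\<close> demands nonempty blocks, and \<open>inj_on\<close> that the blocks are listed without
  repetition.
\<close>

definition splitting_data ::
  "('a,'b) pre_digraph \<Rightarrow> ('a \<Rightarrow> nat) \<Rightarrow> ('a \<Rightarrow> nat \<Rightarrow> 'b set) \<Rightarrow> bool" where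
  "splitting_data E m P \<longleftrightarrow> (\<forall>v\<in>verts E.
     if in_arcs E v = {} then m v = 1
     else partition_on (in_arcs E v) (P v ` {1..m v}) \<and> inj_on (P v) {1..m v})"

definition in_split ::
  "('a,'b) pre_digraph \<Rightarrow> ('a \<Rightarrow> nat) \<Rightarrow> ('a \<Rightarrow> nat \<Rightarrow> 'b set) \<Rightarrow> ('a \<times> nat, 'b \<times> nat) pre_digraph" where
  "in_split E m P = \<lparr>
     verts = {(v, i). v \<in> verts E \<and> i \<in> {1..m v}},
     arcs = {(e, j). e \<in> arcs E \<and> j \<in> {1..m (tail E e)}},
     tail = (\<lambda>(e, j). (tail E e, j)),
     head = (\<lambda>(e, j). (head E e, THE i. i \<in> {1..m (head E e)} \<and> e \<in> P (head E e) i)) \<rparr>"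

text \<open>Graphs are considered up to isomorphism, so the vertex and arc types of \<open>F\<close> are free.\<close>

definition in_splitting :: "('a,'b) pre_digraph \<Rightarrow> ('c,'d) pre_digraph \<Rightarrow> bool" where
  "in_splitting E F \<longleftrightarrow> (\<exists>m P. splitting_data E m P \<and> digraph_iso (in_split E m P) F)"

definition transpose_digraph :: "('a,'b) pre_digraph \<Rightarrow> ('a,'b) pre_digraph" where
  "transpose_digraph E = \<lparr> verts = verts E, arcs = arcs E, tail = head E, head = tail E \<rparr>"

definition out_splitting :: "('a,'b) pre_digraph \<Rightarrow> ('c,'d) pre_digraph \<Rightarrow> bool" where
  "out_splitting E F \<longleftrightarrow> in_splitting (transpose_digraph E) (transpose_digraph F)"

text \<open>
  A finite sequence of splittings has to stay inside one type.  Since only finite graphs up to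
  isomorphism matter, the intermediate graphs are taken with vertices and arcs in \<open>nat\<close>.
\<close>

definition splitting_step :: "(nat,nat) pre_digraph \<Rightarrow> (nat,nat) pre_digraph \<Rightarrow> bool" where
  "splitting_step E F \<longleftrightarrow> in_splitting E F \<or> out_splitting E F"

definition transforms_by_splittings :: "('a,'b) pre_digraph \<Rightarrow> (nat,nat) pre_digraph \<Rightarrow> bool" where
  "transforms_by_splittings E F \<longleftrightarrow> (\<exists>E'. digraph_iso E E' \<and> splitting_step\<^sup>*\<^sup>* E' F)"

end

theory Submission
  imports Defs "HOL-Library.Multiset"
begin

text \<open>
  Idea of the proof.  The only moves needed are tiny ones.  Let \<open>e\<close> be an arc that lies on no
  cycle, with range \<open>w\<close>, where \<open>w\<close> has another incoming arc.  Splitting \<open>w\<close> along the partition of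
  its incoming arcs into \<open>{e}\<close> and the rest adds one vertex \<open>x\<close>, lets \<open>e\<close> end at \<open>x\<close> instead of
  \<open>w\<close>, and gives \<open>x\<close> a copy of every arc leaving \<open>w\<close>.  With suitable names the old graph sits
  literally inside the new one, and its cycles are the same arc lists as before (locale
  \<open>detaching\<close>).  Reversing all arcs turns this in-splitting into the dual out-splitting.  If \<open>w\<close>
  has an outgoing arc, the new graph is still connected.

  Call a trail that is not a single arc of a cycle a \<^emph>\<open>crossing\<close>; crossings lead from one cycle to
  a different one, further down.  A detachment acts on crossings in one of two ways.

  \<^item> If \<open>w\<close> is on no cycle, crossings are in bijection with the old ones, with the same ends and
    the same lengths (\<open>separate_heads\<close>, \<open>separate_tails\<close>).  If moreover two arcs of crossings
    ended at \<open>w\<close>, the set of interior vertices of crossings gains a vertex.  Its size is bounded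
    by the total length of all crossings, which does not change; so finitely many such moves lead
    to a graph in which no two crossings share an interior vertex (\<open>separation\<close>).  There a
    crossing is determined by its first arc and also by its last arc.

  \<^item> If \<open>w\<close> lies on a cycle and \<open>e\<close> is the last arc of the crossing \<open>\<alpha>\<close>, then \<open>\<alpha>\<close> is replaced by
    itself prolonged by one step along the cycle, and by its concatenations with the crossings that
    start at \<open>w\<close> (\<open>push_end\<close>).  Dually, the start of \<open>\<alpha>\<close> can be moved one step back along its cycle
    at the price of concatenations with the crossings ending there (\<open>push_start\<close>).

  It remains to find a schedule.  Number the vertices of each cycle by \<open>pos\<close>, and let \<open>lev\<close> decrease
  along crossings.  A crossing from \<open>u\<close> to \<open>v\<close> whose start is moved back \<open>x\<close> times and whose end is
  moved forward \<open>y\<close> times starts and ends at position \<open>0\<close> exactly if \<open>x\<close> is congruent to \<open>pos u\<close> and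
  \<open>y\<close> to \<open>- pos v\<close> modulo the lengths of the two cycles, and its length has then grown by \<open>x + y\<close>.
  The final length aimed at is \<open>N * c * (lev u - lev v) - 5 * N + t\<close> with \<open>t\<close> smaller than the gcd
  of the two lengths, \<open>N\<close> being divisible by all products of two cycle lengths; these are the
  lengths that a normal form tolerates.  As long as a crossing is short compared to this aim, numbers
  \<open>x\<close>, \<open>y\<close>, \<open>t\<close> of this kind exist (\<open>pending_exists\<close>, which is the solution of the coin problem for
  two coins).  The aim is linear in the level drop, with slack \<open>5 * N\<close>, and therefore the
  concatenation of two crossings that respect their aims is short compared to its own aim
  (\<open>pending_compose\<close>).  So no move ever produces a hopeless crossing.

  The schedule terminates: each move trades one crossing for the same one with one move less to
  go, and for finitely many crossings with a larger level drop.  As the level drop is bounded, the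
  multiset of pairs (remaining level drop, remaining length) decreases (\<open>advance\<close>, \<open>settle\<close>).
  When nothing is left to do, all crossings run between vertices of position \<open>0\<close>, have the desired
  lengths, and have disjoint interiors, which is a normal form (\<open>settled_normal_form\<close>).
\<close>

section \<open>Walks and cycles\<close>

definition cyclic_arcs :: "('a,'b) pre_digraph \<Rightarrow> 'b set" where
  "cyclic_arcs E = (\<Union>p\<in>{p. pre_digraph.cycle E p}. set p)"

text \<open>
  Reading the tails and the heads of a walk as two lists that differ by a shift makes its
  behaviour under rotation and reversal a matter of list algebra.
\<close>
lemma (in pre_digraph) cas_iff:
  "cas u p v \<longleftrightarrow> map (tail G) p @ [v] = u # map (head G) p"
  by (induction p arbitrary: u) auto

lemma (in wf_digraph) awalk_append_ex:
  "awalk u (p @ q) v \<longleftrightarrow> (\<exists>w. awalk u p w \<and> awalk w q v)"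
  by (metis awalk_append_iff awalk_appendI awlast_of_awalk)

lemma (in wf_digraph) cycle_iff_rotate1:
  "cycle p \<longleftrightarrow> p \<noteq> [] \<and> set p \<subseteq> arcs G \<and> distinct (map (tail G) p) \<and>
     map (head G) p = rotate1 (map (tail G) p)"
proof (cases p)
  case Nil
  then show ?thesis by (simp add: cycle_def)
next
  case (Cons e q)
  have *: "awalk u p u \<longleftrightarrow> set p \<subseteq> arcs G \<and> u = tail G e \<and> map (head G) p = rotate1 (map (tail G) p)" for u
    by (auto simp: awalk_def cas_iff Cons)
  have **: "distinct (tl (awalk_verts u p)) \<longleftrightarrow> distinct (map (tail G) p)"
    if "map (head G) p = rotate1 (map (tail G) p)" for u
  proof -
    have "head G (last p) = last (map (head G) p)" by (simp add: Cons last_map)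
    also have "\<dots> = tail G e" unfolding that by (simp add: Cons)
    finally show ?thesis by (auto simp: awalk_verts_conv Cons)
  qed
  show ?thesis
    unfolding cycle_def * using ** Cons by blast
qed

text \<open>A shortest way back from the head of an arc to its tail closes up to a cycle.\<close>
lemma (in wf_digraph) cyclic_arcs_iff:
  "e \<in> cyclic_arcs G \<longleftrightarrow> e \<in> arcs G \<and> head G e \<rightarrow>\<^sup>* tail G e"
proof
  assume "e \<in> cyclic_arcs G"
  then obtain p u where p: "awalk u p u" "e \<in> set p"
    by (auto simp: cyclic_arcs_def cycle_def)
  then obtain xs ys where "p = xs @ e # ys" by (meson split_list)
  with p show "e \<in> arcs G \<and> head G e \<rightarrow>\<^sup>* tail G e"
    by (auto simp: awalk_append_ex awalk_Cons_iff dest!: reachable_awalkI intro: reachable_trans)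
next
  assume e: "e \<in> arcs G \<and> head G e \<rightarrow>\<^sup>* tail G e"
  then obtain q where q: "apath (head G e) q (tail G e)"
    by (auto simp: reachable_apath)
  then have "cycle (e # q)"
    using e unfolding cycle_def apath_def by (intro exI[of _ "tail G e"]) (simp add: awalk_Cons_iff)
  then show "e \<in> cyclic_arcs G"
    unfolding cyclic_arcs_def by force
qed

lemma (in pre_digraph) cyclic_arcs_subset: "cyclic_arcs G \<subseteq> arcs G"
  by (auto simp: cyclic_arcs_def cycle_def awalk_def)

lemma rotations_self [simp]: "p \<in> rotations p"
  unfolding rotations_def by (auto intro: exI[of _ 0])

lemma set_rotations: "q \<in> rotations p \<Longrightarrow> set q = set p"
  by (auto simp: rotations_def)

lemma cycle_verts_rotations: "cycle_verts E (rotations p) = tail E ` set p"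
proof -
  have "\<forall>q\<in>rotations p. set q = set p" by (auto simp: set_rotations)
  then show ?thesis
    unfolding cycle_verts_def using rotations_self[of p] by fastforce
qed

lemma cyclic_verts_eq_tails: "cyclic_verts E = tail E ` cyclic_arcs E"
  by (auto simp: cyclic_verts_def cycles_def cycle_verts_rotations cyclic_arcs_def)

lemma (in wf_digraph) cyclic_verts_eq_heads: "cyclic_verts G = head G ` cyclic_arcs G"
proof -
  have "head G ` set p = tail G ` set p" if "cycle p" for p
    using that unfolding cycle_iff_rotate1
    by (metis list.set_map set_rotate1)
  then show ?thesis
    unfolding cyclic_verts_eq_tails cyclic_arcs_def image_UN by auto
qed

lemma (in wf_digraph) cyclic_verts_subset: "cyclic_verts G \<subseteq> verts G"
  using cyclic_arcs_subset by (auto simp: cyclic_verts_eq_tails)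

lemma (in wf_digraph) closed_walk_cyclic:
  assumes "awalk u p u" "e \<in> set p"
  shows "e \<in> cyclic_arcs G"
proof -
  obtain xs ys where "p = xs @ e # ys" using assms by (meson split_list)
  with assms show ?thesis
    by (auto simp: cyclic_arcs_iff awalk_append_ex awalk_Cons_iff dest!: reachable_awalkI intro: reachable_trans)
qed

lemma (in wf_digraph) cycle_rotate: "cycle p \<Longrightarrow> cycle (rotate k p)"
  unfolding cycle_iff_rotate1
  by (metis distinct_rotate map_is_Nil_conv rotate1_rotate_swap rotate_is_Nil_conv rotate_map set_rotate)

lemma rotations_rotate: "rotations (rotate k p) = rotations p"
proof -
  have 1: "rotate j (rotate k p) \<in> rotations p" for j
    by (auto simp: rotations_def rotate_rotate)
  have 2: "rotate j p \<in> rotations (rotate k p)" for j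
  proof (cases "p = []")
    case False
    have "k \<le> length p * k" using False by (cases p) auto
    then have "j + (length p * k - k) + k = j + length p * k" by linarith
    then have "(j + (length p * k - k) + k) mod length p = j mod length p"
      by (metis mod_mult_self2)
    then obtain i where "(i + k) mod length p = j mod length p" by blast
    then have "rotate j p = rotate i (rotate k p)"
      by (metis rotate_conv_mod rotate_rotate)
    then show ?thesis by (auto simp: rotations_def)
  qed (auto simp: rotations_def)
  from 1 2 show ?thesis unfolding rotations_def[of p] rotations_def[of "rotate k p"]
    by (auto simp: rotations_def)
qed

lemma (in wf_digraph) cycle_at_iff: "cycle_at G v p \<longleftrightarrow> cycle p \<and> tail G (hd p) = v"
proof -
  have "awalk v p v \<longleftrightarrow> tail G (hd p) = v" if c: "cycle p"
  proof -
    obtain u where "awalk u p u" "p \<noteq> []" using c unfolding cycle_def by blast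
    then show ?thesis by (cases p) (auto simp: awalk_Cons_iff)
  qed
  then show ?thesis by (auto simp: cycle_at_def)
qed

lemma (in wf_digraph) cycle_through:
  assumes "cycle p" "e \<in> set p"
  obtains q where "q \<in> rotations p" "rotations q = rotations p" "cycle q" "hd q = e"
proof -
  obtain k where k: "k < length p" "p ! k = e" using assms by (meson in_set_conv_nth)
  then have "hd (rotate k p) = e" by (metis hd_rotate_conv_nth list.size(3) mod_less not_less_zero)
  with assms(1) show ?thesis
    using that[of "rotate k p"] rotations_rotate[of k p] cycle_rotate rotations_self[of "rotate k p"]
    by metis
qed

section \<open>Crossings\<close>

text \<open>The trails that are not single arcs of cycles, see \<open>cycle_trail_iff\<close> below.\<close>
definition crossing :: "('a,'b) pre_digraph \<Rightarrow> 'a \<Rightarrow> 'b list \<Rightarrow> 'a \<Rightarrow> bool" where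
  "crossing E u p v \<longleftrightarrow> pre_digraph.awalk E u p v \<and> p \<noteq> [] \<and>
     u \<in> cyclic_verts E \<and> v \<in> cyclic_verts E \<and>
     (\<forall>e\<in>set (tl p). tail E e \<notin> cyclic_verts E) \<and> set p \<inter> cyclic_arcs E = {}"

definition crossings :: "('a,'b) pre_digraph \<Rightarrow> 'b list set" where
  "crossings E = {p. \<exists>u v. crossing E u p v}"

context wf_digraph begin

lemma awalk_hd_last:
  "awalk u p v \<Longrightarrow> p \<noteq> [] \<Longrightarrow> u = tail G (hd p) \<and> v = head G (last p)"
proof -
  assume "awalk u p v" "p \<noteq> []"
  then have "map (tail G) p @ [v] = u # map (head G) p" by (auto simp: awalk_def cas_iff)
  then have "hd (map (tail G) p @ [v]) = u" "v = last (u # map (head G) p)"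
    by (simp, metis last_snoc)
  then show ?thesis using \<open>p \<noteq> []\<close> by (simp add: hd_map last_map)
qed

lemma crossing_ends:
  assumes "crossing G u p v"
  shows "trail_source G p = u" "trail_range G p = v"
  using assms awalk_hd_last by (auto simp: crossing_def trail_source_def trail_range_def)

lemma crossings_iff: "p \<in> crossings G \<longleftrightarrow> crossing G (trail_source G p) p (trail_range G p)"
  using crossing_ends by (auto simp: crossings_def)

lemma cyclic_arc_trail: "f \<in> cyclic_arcs G \<Longrightarrow> cycle_trail G [f]"
  using cyclic_arcs_subset
  by (auto simp: cycle_trail_def awalk_Cons_iff awalk_Nil_iff cyclic_verts_eq_heads
      intro: exI[of _ "tail G f"]) (auto simp flip: cyclic_verts_eq_heads simp: cyclic_verts_eq_tails)

text \<open>
  Both ends of a cyclic arc are cyclic vertices, while a trail meets cyclic vertices only at its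
  ends; so a trail that uses a cyclic arc has no room for anything else.
\<close>
lemma cycle_trail_iff: "cycle_trail G p \<longleftrightarrow> (\<exists>f\<in>cyclic_arcs G. p = [f]) \<or> p \<in> crossings G"
proof
  assume p: "cycle_trail G p"
  then obtain u v where uv: "awalk u p v" "u \<in> cyclic_verts G" "v \<in> cyclic_verts G" "p \<noteq> []"
    and tl: "\<forall>e\<in>set (tl p). tail G e \<notin> cyclic_verts G"
    by (auto simp: cycle_trail_def)
  show "(\<exists>f\<in>cyclic_arcs G. p = [f]) \<or> p \<in> crossings G"
  proof (cases "set p \<inter> cyclic_arcs G = {}")
    case True
    with uv tl show ?thesis by (auto simp: crossings_def crossing_def)
  next
    case False
    then obtain f where f0: "f \<in> cyclic_arcs G" "f \<in> set p" by auto
    then obtain xs ys where f: "f \<in> cyclic_arcs G" "p = xs @ f # ys"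
      by (meson split_list)
    have "tail G f \<in> cyclic_verts G" "head G f \<in> cyclic_verts G"
      using f(1) by (auto simp: cyclic_verts_eq_tails) (auto simp flip: cyclic_verts_eq_tails simp: cyclic_verts_eq_heads)
    with f tl uv have "xs = []" "ys = []"
      by (cases xs; cases ys; auto simp: awalk_append_ex awalk_Cons_iff)+
    with f show ?thesis by auto
  qed
next
  assume "(\<exists>f\<in>cyclic_arcs G. p = [f]) \<or> p \<in> crossings G"
  then show "cycle_trail G p"
    using cyclic_arc_trail by (auto simp: crossings_def crossing_def cycle_trail_def)
qed

lemma interior_verts_cyclic_arc: "f \<in> cyclic_arcs G \<Longrightarrow> interior_verts G [f] = {}"
  by (auto simp: interior_verts_def cyclic_verts_eq_tails)
     (auto simp flip: cyclic_verts_eq_tails simp: cyclic_verts_eq_heads)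

lemma crossing_arcs: "crossing G u p v \<Longrightarrow> set p \<subseteq> arcs G"
  by (auto simp: crossing_def)

text \<open>A repeated arc would lie on a closed walk; this is what makes the set of crossings finite.\<close>
lemma crossing_distinct:
  assumes "crossing G u p v"
  shows "distinct p"
proof (rule ccontr)
  assume "\<not> distinct p"
  then obtain xs e ys zs where p: "p = xs @ [e] @ ys @ [e] @ zs"
    using not_distinct_decomp by blast
  with assms have "awalk (tail G e) (e # ys) (tail G e)"
    by (auto simp: crossing_def awalk_append_ex awalk_Cons_iff)
  then have "e \<in> cyclic_arcs G" by (rule closed_walk_cyclic) simp
  with assms p show False by (auto simp: crossing_def)
qed

lemma crossing_split:
  assumes "crossing G u (xs @ e # ys) v"
  shows "tail G e \<in> cyclic_verts G \<longleftrightarrow> xs = []" "head G e \<in> cyclic_verts G \<longleftrightarrow> ys = []"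
    "xs = [] \<Longrightarrow> tail G e = u" "ys = [] \<Longrightarrow> head G e = v"
    "e \<in> arcs G" "awalk u xs (tail G e)" "awalk (head G e) ys v" "e \<notin> cyclic_arcs G"
  using assms
  by (cases xs; cases ys; auto simp: crossing_def awalk_append_ex awalk_Cons_iff awalk_Nil_iff)+

end

lemma (in fin_digraph) finite_crossings: "finite (crossings G)"
proof (rule finite_subset)
  show "crossings G \<subseteq> {p. set p \<subseteq> arcs G \<and> distinct p}"
    using crossing_arcs crossing_distinct by (auto simp: crossings_def)
  show "finite {p. set p \<subseteq> arcs G \<and> distinct p}"
    using finite_subset_distinct[OF finite_arcs] by simp
qed

section \<open>Transposition\<close>

text \<open>
  Walks, cycles and crossings of the transposed graph are the reversed ones.  Every
  statement about in-splittings thereby yields one about out-splittings.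
\<close>

lemma transpose_simps [simp]:
  "verts (transpose_digraph E) = verts E" "arcs (transpose_digraph E) = arcs E"
  "tail (transpose_digraph E) = head E" "head (transpose_digraph E) = tail E"
  "transpose_digraph (transpose_digraph E) = E"
  by (auto simp: transpose_digraph_def)

lemma fin_digraph_transpose [simp]: "fin_digraph (transpose_digraph E) \<longleftrightarrow> fin_digraph E"
  by (auto simp: fin_digraph_def fin_digraph_axioms_def wf_digraph_def)

lemma wf_digraph_transpose [simp]: "wf_digraph (transpose_digraph E) \<longleftrightarrow> wf_digraph E"
  by (auto simp: wf_digraph_def)

lemma connected_transpose [simp]:
  "Digraph_Component.connected (transpose_digraph E) \<longleftrightarrow> Digraph_Component.connected E"
proof -
  have "symcl (arcs_ends (transpose_digraph E)) = symcl (arcs_ends E)"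
    by (auto simp: symcl_def arcs_ends_conv)
  then show ?thesis by (simp add: connected_conv)
qed

context wf_digraph begin

lemma cas_transpose: "pre_digraph.cas (transpose_digraph G) v (rev p) u \<longleftrightarrow> cas u p v"
proof -
  have "pre_digraph.cas (transpose_digraph G) v (rev p) u \<longleftrightarrow>
    rev (map (head G) (rev p) @ [u]) = rev (v # map (tail G) (rev p))"
    by (simp add: pre_digraph.cas_iff del: rev.simps rev_append)
  also have "\<dots> \<longleftrightarrow> cas u p v" by (auto simp: cas_iff rev_map)
  finally show ?thesis .
qed

lemma awalk_transpose: "pre_digraph.awalk (transpose_digraph G) v (rev p) u \<longleftrightarrow> awalk u p v"
proof -
  interpret T: wf_digraph "transpose_digraph G" using wf_digraph by simp
  have "u \<in> verts G \<and> set p \<subseteq> arcs G \<and> cas u p v \<longleftrightarrow> v \<in> verts G \<and> set p \<subseteq> arcs G \<and> cas u p v"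
    by (metis T.awalk_def T.awalk_last_in_verts awalk_def awalk_last_in_verts cas_transpose set_rev
        transpose_simps(1) transpose_simps(2))
  then show ?thesis by (auto simp: pre_digraph.awalk_def cas_transpose)
qed

lemma cycle_transpose: "pre_digraph.cycle (transpose_digraph G) (rev p) \<longleftrightarrow> cycle p"
proof -
  interpret T: wf_digraph "transpose_digraph G" using wf_digraph by simp
  have r: "rotate1 (rev (rotate1 xs)) = rev xs" for xs :: "'a list"
    by (cases xs) auto
  have "map (tail G) (rev p) = rotate1 (map (head G) (rev p)) \<longleftrightarrow> map (head G) p = rotate1 (map (tail G) p)"
  proof
    assume "map (tail G) (rev p) = rotate1 (map (head G) (rev p))"
    then have "map (tail G) p = rev (rotate1 (rev (map (head G) p)))"
      by (simp add: rev_map flip: rev_swap)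
    then show "map (head G) p = rotate1 (map (tail G) p)" by (simp add: r)
  next
    assume "map (head G) p = rotate1 (map (tail G) p)"
    then have "rotate1 (rev (map (head G) p)) = rev (map (tail G) p)" by (simp add: r)
    then show "map (tail G) (rev p) = rotate1 (map (head G) (rev p))" by (simp add: rev_map)
  qed
  moreover have "distinct (map (head G) p) \<longleftrightarrow> distinct (map (tail G) p)"
    if "map (head G) p = rotate1 (map (tail G) p)" using that by simp
  ultimately show ?thesis
    unfolding cycle_iff_rotate1 T.cycle_iff_rotate1 by (auto simp flip: rev_map)
qed

lemma cyclic_arcs_transpose [simp]: "cyclic_arcs (transpose_digraph G) = cyclic_arcs G"
proof -
  have "pre_digraph.cycle (transpose_digraph G) p \<longleftrightarrow> cycle (rev p)" for p
    using cycle_transpose[of "rev p"] by simp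
  then have "e \<in> cyclic_arcs (transpose_digraph G) \<longleftrightarrow> (\<exists>p. cycle (rev p) \<and> e \<in> set (rev p))" for e
    by (simp add: cyclic_arcs_def)
  moreover have "(\<exists>p. cycle (rev p) \<and> e \<in> set (rev p)) \<longleftrightarrow> e \<in> cyclic_arcs G" for e
    by (auto simp: cyclic_arcs_def simp del: set_rev) (metis rev_rev_ident)
  ultimately show ?thesis by blast
qed

lemma cyclic_verts_transpose [simp]: "cyclic_verts (transpose_digraph G) = cyclic_verts G"
  by (simp add: cyclic_verts_eq_heads) (simp add: cyclic_verts_eq_tails)

lemma crossing_transpose: "crossing (transpose_digraph G) v (rev p) u \<longleftrightarrow> crossing G u p v"
proof -
  have "set (map (head G) (butlast p)) = set (map (tail G) (tl p))" if "awalk u p v"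
  proof -
    have "map (tail G) p @ [v] = u # map (head G) p"
      using that by (auto simp: awalk_def cas_iff)
    then have "butlast (tl (map (tail G) p @ [v])) = butlast (map (head G) p)" by simp
    then have "map (tail G) (tl p) = map (head G) (butlast p)"
      by (cases p) (auto simp: map_butlast)
    then show ?thesis by simp
  qed
  moreover have "tl (rev p) = rev (butlast p)" by (cases p rule: rev_cases) auto
  ultimately have "head G ` set (tl (rev p)) = tail G ` set (tl p)" if "awalk u p v"
    using that by simp
  moreover have avoid: "(\<forall>e\<in>S. f e \<notin> Z) \<longleftrightarrow> f ` S \<inter> Z = {}" for S :: "'b set" and f :: "'b \<Rightarrow> 'a" and Z
    by auto
  ultimately show ?thesis
    unfolding crossing_def awalk_transpose avoid cyclic_verts_transpose cyclic_arcs_transpose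
      transpose_simps set_rev rev_is_Nil_conv by (cases "awalk u p v") auto
qed

lemma crossings_transpose: "crossings (transpose_digraph G) = rev ` crossings G"
proof -
  have "p \<in> crossings (transpose_digraph G) \<longleftrightarrow> rev p \<in> crossings G" for p
  proof -
    have "crossing (transpose_digraph G) v p u \<longleftrightarrow> crossing G u (rev p) v" for u v
      using crossing_transpose[of v "rev p" u] by simp
    then show ?thesis unfolding crossings_def by blast
  qed
  then have "crossings (transpose_digraph G) = rev -` crossings G" by blast
  moreover have "rev -` A = rev ` A" for A :: "'b list set"
  proof (intro equalityI subsetI)
    fix p assume "p \<in> rev -` A"
    then show "p \<in> rev ` A" using image_eqI[of p rev "rev p" A] by simp
  qed auto
  ultimately show ?thesis by simp
qed

end

section \<open>Detaching an arc\<close>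

definition crossing_arcs :: "('a,'b) pre_digraph \<Rightarrow> 'b set" where
  "crossing_arcs E = (\<Union>p\<in>crossings E. set p)"

lemma crossing_arcsI: "crossing E u p v \<Longrightarrow> a \<in> set p \<Longrightarrow> a \<in> crossing_arcs E"
  unfolding crossing_arcs_def crossings_def by blast

lemma crossing_arcsE:
  assumes "a \<in> crossing_arcs E"
  obtains u xs ys v where "crossing E u (xs @ a # ys) v"
  using assms unfolding crossing_arcs_def crossings_def by (auto dest: split_list)

text \<open>
  By \<open>interior_vert_head\<close> below this is the union of the interiors of all crossings: an interior
  vertex is entered by the crossing as well as left.
\<close>
definition crossing_interior :: "('a,'b) pre_digraph \<Rightarrow> 'a set" where
  "crossing_interior E = head E ` crossing_arcs E - cyclic_verts E"

text \<open>
  The in-splitting of \<open>E\<close> at the head \<open>w\<close> of \<open>e\<close> that separates \<open>e\<close> from the other arcs into \<open>w\<close>.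
  Of the two copies of \<open>w\<close>, the one entered by the other arcs keeps the name \<open>w\<close> and the one
  entered by \<open>e\<close> is \<open>x\<close>; the copy at \<open>x\<close> of an arc \<open>f\<close> out of \<open>w\<close> is \<open>c f\<close>.  With this choice of names
  everything in \<open>E\<close> away from \<open>e\<close> remains verbatim in \<open>F\<close>.  The arc out of \<open>w\<close> keeps \<open>F\<close> connected:
  detaching an arc into a sink might disconnect the graph.
\<close>
locale detaching = E: fin_digraph E for E :: "('a,'b) pre_digraph" +
  fixes F :: "('a,'b) pre_digraph" and e :: 'b and x :: 'a and c :: "'b \<Rightarrow> 'b"
  assumes e: "e \<in> arcs E" "e \<notin> cyclic_arcs E"
    and other_in: "\<exists>e'\<in>arcs E. e' \<noteq> e \<and> head E e' = head E e"
    and some_out: "out_arcs E (head E e) \<noteq> {}"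
    and x_new: "x \<notin> verts E"
    and c_inj: "inj_on c (out_arcs E (head E e))"
    and c_new: "c ` out_arcs E (head E e) \<inter> arcs E = {}"
    and verts_F: "verts F = insert x (verts E)"
    and arcs_F: "arcs F = arcs E \<union> c ` out_arcs E (head E e)"
    and tail_F: "\<And>a. a \<in> arcs E \<Longrightarrow> tail F a = tail E a"
    and tail_c: "\<And>f. f \<in> out_arcs E (head E e) \<Longrightarrow> tail F (c f) = x"
    and head_e: "head F e = x"
    and head_F: "\<And>a. a \<in> arcs E \<Longrightarrow> a \<noteq> e \<Longrightarrow> head F a = head E a"
    and head_c: "\<And>f. f \<in> out_arcs E (head E e) \<Longrightarrow> head F (c f) = head E f"
begin

abbreviation "w \<equiv> head E e"

lemma e_not_loop: "tail E e \<noteq> w"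
  using e E.cyclic_arcs_iff[of e] E.reachable_refl[of "tail E e"] by fastforce

lemma fin_digraph_F: "fin_digraph F"
proof
  fix a assume "a \<in> arcs F"
  then show "tail F a \<in> verts F" "head F a \<in> verts F"
    using e by (cases "a = e"; auto simp: arcs_F verts_F tail_F tail_c head_e head_F head_c)+
next
  show "finite (verts F)" "finite (arcs F)"
    by (auto simp: verts_F arcs_F out_arcs_def)
qed

sublocale F: fin_digraph F by (rule fin_digraph_F)

lemma head_F_eq_x: "a \<in> arcs F \<Longrightarrow> head F a = x \<longleftrightarrow> a = e"
  using x_new e c_new by (cases "a = e") (auto simp: arcs_F head_e head_F head_c)

lemma c_notin: "tail E f = w \<Longrightarrow> f \<in> arcs E \<Longrightarrow> c f \<notin> arcs E"
  using c_new by (metis IntI emptyE imageI in_out_arcs_conv)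

text \<open>
  The projection of \<open>F\<close> onto \<open>E\<close>.  Walks of \<open>E\<close> lift uniquely along it once the starting vertex is
  lifted, as for every in-splitting.
\<close>
definition prv :: "'a \<Rightarrow> 'a" where "prv y = (if y = x then w else y)"
definition pra :: "'b \<Rightarrow> 'b" where
  "pra a = (if a \<in> arcs E then a else the_inv_into (out_arcs E w) c a)"

lemma pra_c [simp]: "f \<in> out_arcs E w \<Longrightarrow> pra (c f) = f"
  using c_inj by (auto simp: pra_def the_inv_into_f_f c_notin)

lemma pra_old [simp]: "a \<in> arcs E \<Longrightarrow> pra a = a" by (simp add: pra_def)

lemma prv_old [simp]: "y \<in> verts E \<Longrightarrow> prv y = y" "prv x = w"
  using x_new by (auto simp: prv_def)

lemma pra_arc:
  assumes "a \<in> arcs F"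
  shows "pra a \<in> arcs E" "tail E (pra a) = prv (tail F a)" "head E (pra a) = prv (head F a)"
    "pra a = e \<longleftrightarrow> a = e"
proof -
  show "pra a \<in> arcs E" "tail E (pra a) = prv (tail F a)"
    using assms by (auto simp: arcs_F tail_F tail_c)
  show "head E (pra a) = prv (head F a)"
    using assms e by (cases "a = e") (auto simp: arcs_F head_e head_F head_c)
  show "pra a = e \<longleftrightarrow> a = e"
    using assms e_not_loop e c_notin by (auto simp: arcs_F)
qed

lemma prv_verts: "y \<in> verts F \<Longrightarrow> prv y \<in> verts E"
  using e by (auto simp: verts_F)

lemma project_awalk: "F.awalk u p v \<Longrightarrow> E.awalk (prv u) (map pra p) (prv v)"
  by (induction p arbitrary: u)
     (auto simp: F.awalk_Cons_iff E.awalk_Cons_iff F.awalk_Nil_iff E.awalk_Nil_iff pra_arc prv_verts)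

lemma lift_arc:
  assumes "a \<in> arcs E" "y \<in> verts F" "prv y = tail E a"
  obtains b where "b \<in> arcs F" "tail F b = y" "pra b = a"
proof (cases "y = x")
  case True
  with assms that[of "c a"] show ?thesis by (auto simp: arcs_F tail_c)
next
  case False
  with assms that[of a] show ?thesis by (auto simp: arcs_F verts_F tail_F)
qed

lemma lift_awalk:
  "E.awalk u p v \<Longrightarrow> y \<in> verts F \<Longrightarrow> prv y = u \<Longrightarrow>
    \<exists>q z. F.awalk y q z \<and> map pra q = p \<and> prv z = v"
proof (induction p arbitrary: u y)
  case Nil
  then show ?case by (auto simp: F.awalk_Nil_iff E.awalk_Nil_iff)
next
  case (Cons a p)
  then have a: "a \<in> arcs E" "tail E a = u" "E.awalk (head E a) p v"
    by (auto simp: E.awalk_Cons_iff)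
  with Cons.prems obtain b where b: "b \<in> arcs F" "tail F b = y" "pra b = a"
    by (metis lift_arc)
  with Cons.IH[OF a(3), of "head F b"] obtain q z
    where "F.awalk (head F b) q z \<and> map pra q = p \<and> prv z = v"
    using pra_arc(3)[OF b(1)] by auto
  with b have "F.awalk y (b # q) z \<and> map pra (b # q) = a # p \<and> prv z = v"
    by (auto simp: F.awalk_Cons_iff)
  then show ?case by (intro exI[of _ "b # q"] exI[of _ z])
qed

lemma pra_inj:
  assumes "a \<in> arcs F" "b \<in> arcs F" "tail F a = tail F b" "pra a = pra b"
  shows "a = b"
proof -
  have "tail F d = x \<longleftrightarrow> d \<notin> arcs E" "d \<notin> arcs E \<Longrightarrow> \<exists>f\<in>out_arcs E w. d = c f" if "d \<in> arcs F" for d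
    using that x_new c_notin E.tail_in_verts by (auto simp: arcs_F tail_F tail_c)
  with assms show ?thesis by (metis pra_c pra_old)
qed

lemma lift_unique:
  "F.awalk y q z \<Longrightarrow> F.awalk y q' z' \<Longrightarrow> map pra q = map pra q' \<Longrightarrow> q = q'"
proof (induction q arbitrary: y q')
  case (Cons a q)
  then obtain b q'' where "q' = b # q''" by (cases q') auto
  with Cons pra_inj[of a b] show ?case by (auto simp: F.awalk_Cons_iff)
qed simp

lemma avoiding_awalk:
  "e \<notin> set p \<Longrightarrow> y \<in> verts E \<Longrightarrow> F.awalk y p z \<longleftrightarrow> E.awalk y p z"
proof (induction p arbitrary: y)
  case (Cons a p)
  have "a \<in> arcs F \<and> tail F a = y \<longleftrightarrow> a \<in> arcs E \<and> tail E a = y"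
    using Cons.prems x_new by (auto simp: arcs_F tail_F tail_c)
  moreover have "F.awalk (head F a) p z \<longleftrightarrow> E.awalk (head E a) p z" if "a \<in> arcs E"
  proof -
    have "a \<noteq> e" "e \<notin> set p" "head E a \<in> verts E" using Cons.prems that by auto
    then show ?thesis using Cons.IH head_F[OF that] by simp
  qed
  ultimately show ?case
    unfolding F.awalk_Cons_iff E.awalk_Cons_iff by metis
qed (auto simp: F.awalk_Nil_iff E.awalk_Nil_iff verts_F)

text \<open>Between two passages through \<open>e\<close> a walk would project to a closed walk of \<open>E\<close> through \<open>e\<close>.\<close>
lemma e_once:
  assumes "F.awalk u (p @ e # q) v"
  shows "e \<notin> set p" "e \<notin> set q"
proof -
  have no: "e \<notin> set r" if r: "F.awalk x r y" for r y
  proof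
    assume "e \<in> set r"
    then obtain r1 r2 where "r = r1 @ e # r2" by (meson split_list)
    with r have "F.awalk x (r1 @ [e]) x"
      by (auto simp: F.awalk_append_ex F.awalk_Cons_iff F.awalk_Nil_iff head_e verts_F)
    from project_awalk[OF this] have "E.awalk w (map pra (r1 @ [e])) w" by simp
    moreover have "e \<in> set (map pra (r1 @ [e]))" using e by simp
    ultimately have "e \<in> cyclic_arcs E" by (rule E.closed_walk_cyclic)
    with e show False by blast
  qed
  show "e \<notin> set q" using assms no by (auto simp: F.awalk_append_ex F.awalk_Cons_iff head_e)
  show "e \<notin> set p"
  proof
    assume "e \<in> set p"
    then obtain r1 r2 where "p = r1 @ e # r2" by (meson split_list)
    with assms have "F.awalk x (r2 @ e # q) v"
      by (auto simp: F.awalk_append_ex F.awalk_Cons_iff head_e)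
    from no[OF this] show False by simp
  qed
qed

text \<open>
  A closed walk of \<open>F\<close> cannot use \<open>e\<close>, hence never reaches \<open>x\<close>, whose only incoming arc is \<open>e\<close>.
\<close>
lemma closed_awalk_iff:
  assumes "p \<noteq> []"
  shows "F.awalk u p u \<longleftrightarrow> E.awalk u p u"
proof
  assume p: "F.awalk u p u"
  then have "E.awalk (prv u) (map pra p) (prv u)" by (rule project_awalk)
  then have "e \<notin> set (map pra p)" using e E.closed_walk_cyclic by blast
  with e have "e \<notin> set p" by (metis image_eqI list.set_map pra_old)
  moreover have "u \<noteq> x"
    using F.awalk_hd_last[OF p assms] head_F_eq_x[of "last p"] p assms \<open>e \<notin> set p\<close>
    by (metis F.awalkE' last_in_set subsetD)
  ultimately show "E.awalk u p u"
    using p avoiding_awalk F.awalk_hd_in_verts[OF p] by (auto simp: verts_F)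
next
  assume p: "E.awalk u p u"
  then have "e \<notin> set p" using e E.closed_walk_cyclic by blast
  with p avoiding_awalk E.awalk_hd_in_verts[OF p] show "F.awalk u p u" by auto
qed

lemma cycle_iff: "F.cycle p \<longleftrightarrow> E.cycle p"
proof -
  have "F.awalk_verts u p = E.awalk_verts u p" if p: "E.awalk u p u" "p \<noteq> []" for u
  proof -
    have "e \<notin> set p" using p e E.closed_walk_cyclic by blast
    moreover have "set p \<subseteq> arcs E" using p by auto
    ultimately show ?thesis
      by (auto simp: F.awalk_verts_conv E.awalk_verts_conv tail_F head_F subset_iff)
         (metis head_F last_in_set)
  qed
  then show ?thesis
    unfolding F.cycle_def E.cycle_def using closed_awalk_iff by metis
qed

lemma cyclic_arcs_F: "cyclic_arcs F = cyclic_arcs E"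
  by (simp add: cyclic_arcs_def cycle_iff)

lemma cyclic_arc_same:
  assumes "f \<in> cyclic_arcs E"
  shows "tail F f = tail E f" "head F f = head E f"
  using assms e E.cyclic_arcs_subset tail_F[of f] head_F[of f] by auto

lemma cyclic_verts_F: "cyclic_verts F = cyclic_verts E"
  by (simp add: cyclic_verts_eq_tails cyclic_arcs_F cyclic_arc_same)

text \<open>The walk from \<open>tail e\<close> over \<open>x\<close> to the head of an arc \<open>f\<close> out of \<open>w\<close>, and back along \<open>f\<close> to \<open>w\<close>,
  replaces the arc \<open>e\<close> of \<open>E\<close>.\<close>
lemma connected_F:
  assumes "Digraph_Component.connected E"
  shows "Digraph_Component.connected F"
proof -
  define R where "R = rtrancl_on (verts F) ((arcs_ends F)\<^sup>s)"
  have R_trans: "(a,b) \<in> R \<Longrightarrow> (b,d) \<in> R \<Longrightarrow> (a,d) \<in> R" for a b d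
    unfolding R_def by (rule rtrancl_on_trans)
  have "sym ((arcs_ends F)\<^sup>s)" by (force simp: sym_def symcl_def)
  then have R_sym: "(a,b) \<in> R \<Longrightarrow> (b,a) \<in> R" for a b
    unfolding R_def by (metis rtrancl_on_sym symD)
  have R_arc: "(tail F a, head F a) \<in> R" if "a \<in> arcs F" for a
    unfolding R_def using that F.wellformed[of a]
    by (intro rtrancl_on_into_rtrancl_on[OF rtrancl_on_refl]) (auto simp: symcl_def arcs_ends_conv)
  have E_arc: "(tail E a, head E a) \<in> R" if a: "a \<in> arcs E" for a
  proof (cases "a = e")
    case False
    then show ?thesis using R_arc[of a] a by (auto simp: arcs_F tail_F head_F)
  next
    case True
    obtain f where f: "f \<in> out_arcs E w" using some_out by blast
    then have "f \<noteq> e" using e_not_loop by auto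
    with f have "(tail E e, x) \<in> R" "(x, head E f) \<in> R" "(w, head E f) \<in> R"
      using R_arc[of e] R_arc[of "c f"] R_arc[of f] e
      by (auto simp: arcs_F tail_F head_F head_e tail_c head_c)
    with True show ?thesis using R_trans R_sym by blast
  qed
  have "(a, b) \<in> R" if "a \<in> verts E" "b \<in> verts E" for a b
  proof -
    have "(a, b) \<in> rtrancl_on (verts E) ((arcs_ends E)\<^sup>s)"
      using assms that by (auto simp: connected_conv)
    then show ?thesis
    proof induction
      case base
      then show ?case by (auto simp: R_def verts_F)
    next
      case (step b d)
      then have "(b, d) \<in> R" using E_arc R_sym by (auto simp: symcl_def arcs_ends_conv)
      with step show ?case using R_trans by blast
    qed
  qed
  moreover have "(tail E e, x) \<in> R" using R_arc[of e] e by (auto simp: arcs_F tail_F head_e)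
  ultimately have "(a, tail E e) \<in> R" if "a \<in> verts F" for a
    using that R_sym e(1) E.tail_in_verts[of e] unfolding verts_F by blast
  then have "(a, b) \<in> R" if "a \<in> verts F" "b \<in> verts F" for a b
    using that R_trans R_sym by blast
  then show ?thesis by (auto simp: connected_conv R_def verts_F)
qed

lemma avoiding_crossing:
  assumes "e \<notin> set p"
  shows "crossing F u p v \<longleftrightarrow> crossing E u p v"
proof -
  have tails: "(\<forall>a\<in>set (tl p). tail F a \<notin> Z) \<longleftrightarrow> (\<forall>a\<in>set (tl p). tail E a \<notin> Z)"
    if "E.awalk u p v" for Z
  proof (rule ball_cong[OF refl])
    fix a assume "a \<in> set (tl p)"
    then have "a \<in> set p" by (cases p) auto
    then have "a \<in> arcs E" using that by auto
    then show "(tail F a \<notin> Z) = (tail E a \<notin> Z)" by (simp add: tail_F)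
  qed
  have walk: "F.awalk u p v \<longleftrightarrow> E.awalk u p v" if "u \<in> cyclic_verts E"
    using that avoiding_awalk[OF assms] E.cyclic_verts_subset by blast
  show ?thesis
    unfolding crossing_def cyclic_verts_F cyclic_arcs_F
    using walk tails[of "cyclic_verts E"] by argo
qed

text \<open>
  At a cyclic vertex \<open>w\<close>, a crossing through \<open>e\<close> no longer stops behind \<open>e\<close>, since \<open>x\<close> is off the
  cycles: it goes on along a copy of an arc out of \<open>w\<close>.  If that arc is cyclic, the next
  vertex already is on the cycle again; otherwise it begins a crossing of \<open>E\<close>.
\<close>
lemma crossing_through:
  assumes w: "w \<in> cyclic_verts E" and p: "crossing F u p v" "e \<in> set p"
  obtains \<alpha> where "crossing E u \<alpha> w" "last \<alpha> = e"
    "(\<exists>f\<in>cyclic_arcs E. tail E f = w \<and> head E f = v \<and> length p = Suc (length \<alpha>)) \<or>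
     (\<exists>\<beta>. crossing E w \<beta> v \<and> length p = length \<alpha> + length \<beta>)"
proof -
  obtain p1 p2 where p12: "p = p1 @ e # p2" using p(2) by (meson split_list)
  note pF = p(1)[unfolded crossing_def cyclic_verts_F cyclic_arcs_F]
  note s = F.crossing_split[OF p(1)[unfolded p12], unfolded cyclic_verts_F cyclic_arcs_F head_e]
  have e12: "e \<notin> set p1" "e \<notin> set p2" using e_once pF p12 by auto
  have uE: "u \<in> verts E" using pF E.cyclic_verts_subset by auto
  have p1: "E.awalk u p1 (tail E e)"
    using s(6) avoiding_awalk[OF e12(1) uE] e by (simp add: tail_F)
  have tails: "tail F a = tail E a" if "a \<in> set (p1 @ [e])" for a
  proof -
    have "set p1 \<subseteq> arcs E" using p1 by auto
    then show ?thesis using that e tail_F[of a] by auto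
  qed
  have alpha: "crossing E u (p1 @ [e]) w"
    unfolding crossing_def
  proof (intro conjI ballI)
    show "E.awalk u (p1 @ [e]) w"
      using p1 e by (auto simp: E.awalk_append_ex E.awalk_Cons_iff E.awalk_Nil_iff)
    show "set (p1 @ [e]) \<inter> cyclic_arcs E = {}" using pF p12 by auto
    fix a assume a: "a \<in> set (tl (p1 @ [e]))"
    then have "a \<in> set (tl p)" unfolding p12 by (cases p1) auto
    moreover have "a \<in> set (p1 @ [e])" using a by (metis list.set_sel(2) tl_Nil)
    ultimately show "tail E a \<notin> cyclic_verts E" using pF tails by auto
  qed (use pF w in auto)
  have "p2 \<noteq> []" using s x_new E.cyclic_verts_subset by auto
  then obtain b p3 where p2: "p2 = b # p3" by (cases p2) auto
  then have b: "b \<in> arcs F" "tail F b = x" "F.awalk (head F b) p3 v"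
    using s(7) by (auto simp: F.awalk_Cons_iff)
  then obtain f where f: "f \<in> out_arcs E w" "b = c f"
    using x_new by (auto simp: arcs_F tail_F)
  have hf: "head F b = head E f" using f by (simp add: head_c)
  have e3: "e \<notin> set p3" using e12 p2 by auto
  have hfE: "head E f \<in> verts E" using f by auto
  have p3: "E.awalk (head E f) p3 v"
    using b(3) avoiding_awalk[OF e3 hfE] hf by simp
  have len: "length p = length (p1 @ [e]) + length (f # p3)" by (simp add: p12 p2)
  have tails3: "\<forall>a\<in>set p3. tail E a \<notin> cyclic_verts E"
  proof
    fix a assume a: "a \<in> set p3"
    have "set p3 \<subseteq> arcs E" using p3 by auto
    then have "a \<in> arcs E" using a by auto
    moreover have "a \<in> set (tl p)" using a unfolding p12 p2 by (cases p1) auto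
    ultimately show "tail E a \<notin> cyclic_verts E" using pF tail_F[of a] by auto
  qed
  show thesis
  proof (rule that[OF alpha], goal_cases)
    case 1 show ?case by simp
  next
    case 2
    show ?case
    proof (cases "f \<in> cyclic_arcs E")
      case True
      \<comment> \<open>Then the head of \<open>f\<close> is cyclic, and the crossing has to end there.\<close>
      then have "head E f \<in> cyclic_verts E" by (simp add: E.cyclic_verts_eq_heads)
      moreover have "p3 = [] \<or> tail E (hd p3) = head E f"
        using p3 by (cases p3) (auto simp: E.awalk_Cons_iff)
      ultimately have "p3 = []" using tails3 by (cases p3) auto
      with p3 have "head E f = v" by (simp add: E.awalk_Nil_iff)
      with True f \<open>p3 = []\<close> len show ?thesis by auto
    next
      case False
      have "crossing E w (f # p3) v"
        unfolding crossing_def using False p3 f tails3 w pF p12 p2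
        by (auto simp: E.awalk_Cons_iff)
      with len show ?thesis by blast
    qed
  qed
qed

text \<open>
  At a vertex \<open>w\<close> off the cycles, projection and lifting preserve being off the cycles, so that
  the crossings of the two graphs correspond to each other.
\<close>
lemma crossing_project:
  assumes w: "w \<notin> cyclic_verts E" and p: "crossing F u p v"
  shows "crossing E u (map pra p) v"
proof -
  note pF = p[unfolded crossing_def cyclic_verts_F cyclic_arcs_F]
  have uv: "prv u = u" "prv v = v" using pF E.cyclic_verts_subset by auto
  have arcs: "set p \<subseteq> arcs F" using pF by auto
  have "tail E (pra a) \<notin> cyclic_verts E" if "a \<in> set (tl p)" for a
  proof -
    have "a \<in> set p" using that by (metis list.set_sel(2) tl_Nil)
    then show ?thesis using that pF w arcs by (auto simp: pra_arc prv_def subset_iff)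
  qed
  moreover have "pra a \<notin> cyclic_arcs E" if a: "a \<in> set p" for a
  proof (cases "a \<in> arcs E")
    case True
    then show ?thesis using a pF by auto
  next
    case False
    then have "tail E (pra a) = w" using arcs a by (auto simp: arcs_F)
    then show ?thesis using w unfolding cyclic_verts_eq_tails by (metis image_eqI)
  qed
  moreover have "E.awalk u (map pra p) v" using pF project_awalk[of u p v] uv by simp
  ultimately show ?thesis
    using pF unfolding crossing_def by (auto simp flip: map_tl)
qed

lemma crossing_lift:
  assumes w: "w \<notin> cyclic_verts E" and p: "crossing E u p v"
  obtains q where "crossing F u q v" "map pra q = p"
proof -
  note pE = p[unfolded crossing_def]
  have u: "u \<in> verts F" "prv u = u" using pE E.cyclic_verts_subset by (auto simp: verts_F)
  obtain q z where q: "F.awalk u q z" "map pra q = p" "prv z = v"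
    using lift_awalk[of u p v u] u pE by auto
  have "z = v" using q w pE by (auto simp: prv_def split: if_splits)
  have arcs: "set q \<subseteq> arcs F" using q(1) by auto
  have "tail F a \<notin> cyclic_verts E" if "a \<in> set (tl q)" for a
  proof -
    have "pra a \<in> set (tl p)" using that q(2) by (auto simp flip: map_tl)
    moreover have "a \<in> arcs F" using that arcs by (metis list.set_sel(2) tl_Nil subsetD)
    ultimately have "prv (tail F a) \<notin> cyclic_verts E" using pE pra_arc(2)[of a] by auto
    then show ?thesis using E.cyclic_verts_subset prv_old(1)[of "tail F a"] by auto
  qed
  moreover have "a \<notin> cyclic_arcs E" if "a \<in> set q" for a
  proof
    assume a: "a \<in> cyclic_arcs E"
    then have "pra a = a" using E.cyclic_arcs_subset by auto
    moreover have "pra a \<in> set p" using that q(2) by auto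
    ultimately show False using a pE by auto
  qed
  ultimately have "crossing F u q v"
    using q pE \<open>z = v\<close> by (auto simp: crossing_def cyclic_verts_F cyclic_arcs_F)
  with q that show thesis by blast
qed

lemma crossings_bij:
  assumes w: "w \<notin> cyclic_verts E"
  shows "bij_betw (map pra) (crossings F) (crossings E)"
  unfolding bij_betw_def
proof
  show "inj_on (map pra) (crossings F)"
  proof (rule inj_onI)
    fix p q assume pq: "p \<in> crossings F" "q \<in> crossings F" "map pra p = map pra q"
    then obtain u v u' v' where c: "crossing F u p v" "crossing F u' q v'" by (auto simp: crossings_def)
    then have "u = u'"
      using crossing_project[OF w c(1)] crossing_project[OF w c(2)] pq(3) E.crossing_ends by metis
    with c pq(3) show "p = q" using lift_unique by (auto simp: crossing_def)
  qed
  show "map pra ` crossings F = crossings E"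
  proof
    show "map pra ` crossings F \<subseteq> crossings E"
      unfolding crossings_def using crossing_project[OF w] by blast
    show "crossings E \<subseteq> map pra ` crossings F"
    proof
      fix p assume "p \<in> crossings E"
      then obtain u v where "crossing E u p v" by (auto simp: crossings_def)
      then obtain q where "crossing F u q v" "map pra q = p" using crossing_lift[OF w] by blast
      then show "p \<in> map pra ` crossings F" by (auto simp: crossings_def)
    qed
  qed
qed

text \<open>
  The vertex \<open>w\<close> stays in the interior of the crossing through \<open>e'\<close>, while \<open>x\<close> is in the interior of
  the one through \<open>e\<close>.
\<close>
lemma crossing_interior_grow:
  assumes w: "w \<notin> cyclic_verts E" and e: "e \<in> crossing_arcs E"
    and e': "e' \<in> crossing_arcs E" "e' \<noteq> e" "head E e' = w"
  shows "insert x (crossing_interior E) \<subseteq> crossing_interior F"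
proof -
  have lift: "\<exists>b\<in>crossing_arcs F. pra b = a \<and> prv (head F b) = head E a \<and> (head F b = x \<longleftrightarrow> a = e)"
    if "a \<in> crossing_arcs E" for a
  proof -
    obtain p u v where "crossing E u p v" "a \<in> set p"
      using \<open>a \<in> _\<close> by (auto simp: crossing_arcs_def crossings_def)
    then obtain q where q: "crossing F u q v" "map pra q = p" using crossing_lift[OF w] by blast
    with \<open>a \<in> set p\<close> obtain b where b: "b \<in> set q" "pra b = a" by auto
    then have "b \<in> crossing_arcs F" using q by (auto simp: crossing_arcs_def crossings_def)
    moreover have "b \<in> arcs F" using b q F.crossing_arcs by auto
    ultimately show ?thesis using b pra_arc head_F_eq_x by metis
  qed
  have inF: "head F b \<in> crossing_interior F" if "b \<in> crossing_arcs F" "head F b \<notin> cyclic_verts E" for b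
    using that by (auto simp: crossing_interior_def cyclic_verts_F)
  have xZ: "x \<notin> cyclic_verts E" using x_new E.cyclic_verts_subset by auto
  have "x \<in> crossing_interior F" using lift[OF e] inF xZ by metis
  moreover have "y \<in> crossing_interior F" if y: "y \<in> crossing_interior E" for y
  proof -
    obtain a where a: "a \<in> crossing_arcs E" "y = head E a" "y \<notin> cyclic_verts E"
      using y by (auto simp: crossing_interior_def)
    obtain a' where a': "a' \<in> crossing_arcs E" "y = head E a'" "a' \<noteq> e"
    proof (cases "a = e")
      case True
      with that[of e'] a e' show thesis by simp
    next
      case False
      with that[of a] a show thesis by simp
    qed
    from lift[OF a'(1)] obtain b where b: "b \<in> crossing_arcs F"
      "prv (head F b) = head E a'" "head F b = x \<longleftrightarrow> a' = e" by blast
    then have "head F b = y" using a'(2,3) by (simp add: prv_def)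
    with inF[OF b(1)] a(3) show ?thesis by simp
  qed
  ultimately show ?thesis by blast
qed

end

text \<open>
  The block of \<open>e\<close> gets the number 2, so that index 1 stands for the old name of a vertex or arc
  and index 2, which occurs at \<open>w\<close> only, for the new one.
\<close>
lemma (in detaching) in_splitting_F: "in_splitting E F"
proof -
  define m where "m v = (if v = w then 2 else 1 :: nat)" for v
  define P where "P v i = (if v = w then if i = (1::nat) then in_arcs E w - {e} else {e} else in_arcs E v)"
    for v i
  obtain e' where e': "e' \<in> arcs E" "e' \<noteq> e" "head E e' = w" using other_in by auto
  have iv: "{1..m v} = (if v = w then {1,2} else {1})" for v by (auto simp: m_def)
  have mi: "i \<in> {1..m v} \<longleftrightarrow> i = 1 \<or> v = w \<and> i = 2" for i v by (auto simp: m_def)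
  have block: "(THE i. i \<in> {1..m (head E a)} \<and> a \<in> P (head E a) i) = (if a = e then 2 else 1)"
    if "a \<in> arcs E" for a
    unfolding mi by (rule the_equality) (use that in \<open>auto simp: P_def split: if_splits\<close>)
  have sd: "splitting_data E m P"
    unfolding splitting_data_def
  proof (intro ballI)
    fix v assume "v \<in> verts E"
    show "if in_arcs E v = {} then m v = 1
      else partition_on (in_arcs E v) (P v ` {1..m v}) \<and> inj_on (P v) {1..m v}"
    proof (cases "v = w")
      case True
      have "e \<in> in_arcs E v" using True e by simp
      then have "in_arcs E v \<noteq> {}" by blast
      moreover have "P v ` {1..m v} = {in_arcs E w - {e}, {e}}"
        unfolding iv by (auto simp: P_def True)
      moreover have "partition_on (in_arcs E v) {in_arcs E w - {e}, {e}}"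
        unfolding partition_on_def disjoint_def using e e' True by auto
      moreover have "inj_on (P v) {1..m v}"
        unfolding iv using e by (auto simp: P_def True)
      ultimately show ?thesis by auto
    next
      case False
      then have "P v ` {1..m v} = {in_arcs E v}" unfolding iv by (simp add: P_def)
      moreover have "inj_on (P v) {1..m v}" unfolding iv using False by simp
      ultimately show ?thesis
        using False by (auto simp: partition_on_def m_def disjoint_def)
    qed
  qed
  define S where "S = in_split E m P"
  have S: "verts S = {(v, i). v \<in> verts E \<and> i \<in> {1..m v}}"
    "arcs S = {(a, j). a \<in> arcs E \<and> j \<in> {1..m (tail E a)}}"
    "tail S (a, j) = (tail E a, j)"
    "a \<in> arcs E \<Longrightarrow> head S (a, j) = (head E a, if a = e then 2 else 1)" for a j
    using block[of a] by (auto simp: S_def in_split_def)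
  define hv where "hv = (\<lambda>(v, i). if i = (1::nat) then v else x)"
  define ha where "ha = (\<lambda>(a, j). if j = (1::nat) then a else c a)"
  define hom where "hom = \<lparr>iso_verts = hv, iso_arcs = ha, iso_head = head F, iso_tail = tail F\<rparr>"
  have vS: "(v, i) \<in> verts S \<longleftrightarrow> v \<in> verts E \<and> (i = 1 \<or> v = w \<and> i = 2)" for v i
    unfolding S(1) by (simp only: mem_Collect_eq case_prod_conv mi)
  have aS: "(a, j) \<in> arcs S \<longleftrightarrow> a \<in> arcs E \<and> (j = 1 \<or> tail E a = w \<and> j = 2)" for a j
    unfolding S(2) by (simp only: mem_Collect_eq case_prod_conv mi)
  have "pre_digraph.digraph_isomorphism S hom"
    unfolding pre_digraph.digraph_isomorphism_def
  proof (intro conjI ballI)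
    show "wf_digraph S"
    proof
      fix a assume "a \<in> arcs S"
      then obtain b j where a: "a = (b, j)" "(b, j) \<in> arcs S" by (cases a) auto
      then show "tail S a \<in> verts S" "head S a \<in> verts S"
        unfolding aS by (auto simp: a S(3) S(4) vS)
    qed
    have "inj_on hv (verts S)"
    proof (rule inj_onI, clarify)
      fix v i v' i' assume "(v, i) \<in> verts S" "(v', i') \<in> verts S" "hv (v, i) = hv (v', i')"
      then show "v = v' \<and> i = i'"
        using x_new unfolding vS by (auto simp: hv_def)
    qed
    then show "inj_on (iso_verts hom) (verts S)" by (simp add: hom_def)
    have "inj_on ha (arcs S)"
    proof (rule inj_onI, clarify)
      fix a j a' j' assume "(a, j) \<in> arcs S" "(a', j') \<in> arcs S" "ha (a, j) = ha (a', j')"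
      then show "a = a' \<and> j = j'"
        using c_notin[of a] c_notin[of a'] inj_onD[OF c_inj, of a a'] unfolding aS
        by (auto simp: ha_def)
    qed
    then show "inj_on (iso_arcs hom) (arcs S)" by (simp add: hom_def)
  next
    fix a assume "a \<in> arcs S"
    then obtain b j where a: "a = (b, j)" "(b, j) \<in> arcs S" by (cases a) auto
    then show "iso_verts hom (tail S a) = iso_tail hom (iso_arcs hom a)"
      unfolding aS by (auto simp: a S(3) hom_def hv_def ha_def tail_F tail_c)
    show "iso_verts hom (head S a) = iso_head hom (iso_arcs hom a)"
      using a e_not_loop unfolding aS
      by (cases "b = e") (auto simp: a S(4) hom_def hv_def ha_def head_F head_c head_e)
  qed
  moreover have "F = app_iso hom S"
  proof (rule pre_digraph.equality)
    show "verts F = verts (app_iso hom S)"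
    proof (intro equalityI subsetI)
      fix y assume "y \<in> verts F"
      then have "y = hv (y, 1) \<and> (y, 1) \<in> verts S \<or> y = hv (w, 2) \<and> (w, 2) \<in> verts S"
        using e by (auto simp: verts_F vS hv_def)
      then show "y \<in> verts (app_iso hom S)" by (auto simp: hom_def)
    qed (auto simp: hom_def verts_F vS hv_def)
    show "arcs F = arcs (app_iso hom S)"
    proof (intro equalityI subsetI)
      fix y assume "y \<in> arcs F"
      then have "\<exists>z\<in>arcs S. y = ha z"
      proof (cases "y \<in> arcs E")
        case True
        then have "(y, 1) \<in> arcs S \<and> y = ha (y, 1)" by (simp add: aS ha_def)
        then show ?thesis by blast
      next
        case False
        then obtain f where "f \<in> out_arcs E w" "y = c f" using \<open>y \<in> arcs F\<close> by (auto simp: arcs_F)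
        then have "(f, 2) \<in> arcs S \<and> y = ha (f, 2)" by (simp add: aS ha_def)
        then show ?thesis by blast
      qed
      then show "y \<in> arcs (app_iso hom S)" by (auto simp: hom_def)
    qed (auto simp: hom_def arcs_F aS ha_def)
  qed (simp_all add: hom_def)
  ultimately show ?thesis
    unfolding in_splitting_def digraph_iso_def S_def using sd by blast
qed

text \<open>Natural numbers offer fresh names: shift by more than the largest name in use.\<close>
lemma detaching_exists:
  fixes E :: "(nat,nat) pre_digraph"
  assumes fin: "fin_digraph E" and e: "e \<in> arcs E" "e \<notin> cyclic_arcs E"
    and other: "\<exists>e'\<in>arcs E. e' \<noteq> e \<and> head E e' = head E e"
    and out: "out_arcs E (head E e) \<noteq> {}"
  obtains F x c where "detaching E F e x c"
proof -
  interpret fin_digraph E by (rule fin)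
  define x where "x = Suc (Max (verts E))"
  define k where "k = Suc (Max (arcs E))"
  have x: "x \<notin> verts E" unfolding x_def using Max_ge[OF finite_verts, of "Suc (Max (verts E))"] by linarith
  have k: "a + k \<notin> arcs E" for a unfolding k_def using Max_ge[OF finite_arcs, of "a + Suc (Max (arcs E))"] by linarith
  define F where "F = \<lparr>verts = insert x (verts E),
    arcs = arcs E \<union> (\<lambda>a. a + k) ` out_arcs E (head E e),
    tail = (\<lambda>a. if a \<in> arcs E then tail E a else x),
    head = (\<lambda>a. if a = e then x else if a \<in> arcs E then head E a else head E (a - k))\<rparr>"
  have "detaching E F e x (\<lambda>a. a + k)"
    by unfold_locales (use assms x k in \<open>auto simp: F_def\<close>)
  then show thesis by (rule that)
qed

section \<open>The moves\<close>

definition same_cycles :: "('a,'b) pre_digraph \<Rightarrow> ('a,'b) pre_digraph \<Rightarrow> bool" where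
  "same_cycles E F \<longleftrightarrow> (\<forall>p. pre_digraph.cycle F p \<longleftrightarrow> pre_digraph.cycle E p) \<and>
     (\<forall>f\<in>cyclic_arcs E. tail F f = tail E f \<and> head F f = head E f)"

lemma same_cycles_refl [simp]: "same_cycles E E" by (simp add: same_cycles_def)

lemma same_cycles_arcs: "same_cycles E F \<Longrightarrow> cyclic_arcs F = cyclic_arcs E"
  by (simp add: same_cycles_def cyclic_arcs_def)

lemma same_cycles_verts: "same_cycles E F \<Longrightarrow> cyclic_verts F = cyclic_verts E"
  by (simp add: cyclic_verts_eq_tails same_cycles_arcs) (auto simp: same_cycles_def)

lemma same_cycles_trans: "same_cycles E F \<Longrightarrow> same_cycles F H \<Longrightarrow> same_cycles E H"
  using same_cycles_arcs[of E F] by (simp add: same_cycles_def)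

lemma same_cycles_transpose:
  assumes "wf_digraph E" "wf_digraph F" "same_cycles (transpose_digraph E) (transpose_digraph F)"
  shows "same_cycles E F"
  using assms wf_digraph.cycle_transpose[of E] wf_digraph.cycle_transpose[of F]
  by (auto simp: same_cycles_def wf_digraph.cyclic_arcs_transpose)

lemma (in detaching) same_cycles_F: "same_cycles E F"
  by (simp add: same_cycles_def cycle_iff cyclic_arc_same)

lemma (in wf_digraph) cyclic_arc_at:
  assumes "v \<in> cyclic_verts G"
  obtains f g where "f \<in> cyclic_arcs G" "tail G f = v" "g \<in> cyclic_arcs G" "head G g = v"
  using assms cyclic_verts_eq_heads cyclic_verts_eq_tails[of G] by (metis imageE)

lemma (in wf_digraph) crossing_arcs_transpose [simp]:
  "crossing_arcs (transpose_digraph G) = crossing_arcs G"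
  by (simp add: crossing_arcs_def crossings_transpose)

lemma (in wf_digraph) crossing_interior_transpose [simp]:
  "crossing_interior (transpose_digraph G) = crossing_interior G"
proof -
  have "tail G a \<in> head G ` crossing_arcs G"
    if a: "a \<in> crossing_arcs G" "tail G a \<notin> cyclic_verts G" for a
  proof -
    obtain u xs ys v where p: "crossing G u (xs @ a # ys) v" using a(1) by (rule crossing_arcsE)
    then have xs: "xs \<noteq> []" "awalk u xs (tail G a)"
      using crossing_split(1,6)[OF p] a by auto
    then have "tail G a = head G (last xs)" using awalk_hd_last by blast
    moreover have "last xs \<in> crossing_arcs G" using crossing_arcsI[OF p] xs by simp
    ultimately show ?thesis by blast
  qed
  moreover have "head G a \<in> tail G ` crossing_arcs G"
    if a: "a \<in> crossing_arcs G" "head G a \<notin> cyclic_verts G" for a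
  proof -
    obtain u xs ys v where p: "crossing G u (xs @ a # ys) v" using a(1) by (rule crossing_arcsE)
    then have ys: "ys \<noteq> []" "awalk (head G a) ys v"
      using crossing_split(2,7)[OF p] a by auto
    then have "head G a = tail G (hd ys)" using awalk_hd_last by blast
    moreover have "hd ys \<in> crossing_arcs G" using crossing_arcsI[OF p] ys by simp
    ultimately show ?thesis by blast
  qed
  ultimately show ?thesis unfolding crossing_interior_def crossing_arcs_transpose by auto
qed

lemma (in wf_digraph) crossing_arcs_not_cyclic:
  "a \<in> crossing_arcs G \<Longrightarrow> a \<in> arcs G \<and> a \<notin> cyclic_arcs G"
  using crossing_arcs by (auto simp: crossing_arcs_def crossings_def) (auto simp: crossing_def)

definition graph_step :: "(nat,nat) pre_digraph \<Rightarrow> (nat,nat) pre_digraph \<Rightarrow> bool" where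
  "graph_step E F \<longleftrightarrow> splitting_step E F \<and> fin_digraph F \<and> Digraph_Component.connected F \<and> same_cycles E F"

text \<open>The detachment at a cyclic vertex; the cycle through it supplies the other arc in and an arc out.\<close>
lemma push_end:
  fixes E :: "(nat,nat) pre_digraph"
  assumes fin: "fin_digraph E" and con: "Digraph_Component.connected E"
    and e: "e \<in> crossing_arcs E" and w: "head E e \<in> cyclic_verts E"
  shows "\<exists>F. graph_step E F \<and> (\<forall>u p v. crossing F u p v \<longrightarrow>
      crossing E u p v \<and> e \<notin> set p \<or>
      (\<exists>\<alpha>. crossing E u \<alpha> (head E e) \<and> last \<alpha> = e \<and>
        ((\<exists>f\<in>cyclic_arcs E. tail E f = head E e \<and> head E f = v \<and> length p = Suc (length \<alpha>)) \<or>
         (\<exists>\<beta>. crossing E (head E e) \<beta> v \<and> length p = length \<alpha> + length \<beta>))))"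
proof -
  interpret E: fin_digraph E by (rule fin)
  obtain f g where fg: "f \<in> cyclic_arcs E" "tail E f = head E e" "g \<in> cyclic_arcs E" "head E g = head E e"
    using E.cyclic_arc_at[OF w] by blast
  have eE: "e \<in> arcs E" "e \<notin> cyclic_arcs E" using E.crossing_arcs_not_cyclic e by auto
  have "g \<in> arcs E" "g \<noteq> e" "f \<in> out_arcs E (head E e)"
    using fg E.cyclic_arcs_subset eE by auto
  then have other: "\<exists>e'\<in>arcs E. e' \<noteq> e \<and> head E e' = head E e" and out: "out_arcs E (head E e) \<noteq> {}"
    using fg(4) by blast+
  obtain F x c where "detaching E F e x c"
    by (rule detaching_exists[OF fin eE other out])
  then interpret detaching E F e x c .
  show ?thesis
  proof (intro exI[of _ F] conjI allI impI)
    show "graph_step E F"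
      using in_splitting_F fin_digraph_F connected_F[OF con] same_cycles_F
      by (simp add: graph_step_def splitting_step_def)
    fix u p v assume p: "crossing F u p v"
    show "crossing E u p v \<and> e \<notin> set p \<or>
      (\<exists>\<alpha>. crossing E u \<alpha> (head E e) \<and> last \<alpha> = e \<and>
        ((\<exists>f\<in>cyclic_arcs E. tail E f = head E e \<and> head E f = v \<and> length p = Suc (length \<alpha>)) \<or>
         (\<exists>\<beta>. crossing E (head E e) \<beta> v \<and> length p = length \<alpha> + length \<beta>)))"
    proof (cases "e \<in> set p")
      case True
      then show ?thesis using crossing_through[OF w p True] by metis
    next
      case False
      then show ?thesis using p avoiding_crossing by simp
    qed
  qed
qed

text \<open>The detachment at an interior vertex that is entered by two different arcs of crossings.\<close>
lemma separate_heads: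
  fixes E :: "(nat,nat) pre_digraph"
  assumes fin: "fin_digraph E" and con: "Digraph_Component.connected E"
    and ee: "e \<in> crossing_arcs E" "e' \<in> crossing_arcs E" "e' \<noteq> e" "head E e' = head E e"
    and w: "head E e \<notin> cyclic_verts E"
  shows "\<exists>F h. graph_step E F \<and> bij_betw h (crossings F) (crossings E) \<and>
    (\<forall>u p v. crossing F u p v \<longrightarrow> crossing E u (h p) v \<and> length (h p) = length p) \<and>
    crossing_interior E \<subset> crossing_interior F"
proof -
  interpret E: fin_digraph E by (rule fin)
  have eE: "e \<in> arcs E" "e \<notin> cyclic_arcs E" "e' \<in> arcs E" using E.crossing_arcs_not_cyclic ee by auto
  have "head E e \<in> crossing_interior E" using ee w by (simp add: crossing_interior_def)
  then have "head E e \<in> crossing_interior (transpose_digraph E)" by simp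
  then have "head E e \<in> tail E ` crossing_arcs E"
    unfolding crossing_interior_def E.crossing_arcs_transpose transpose_simps by blast
  then obtain f where "f \<in> crossing_arcs E" "tail E f = head E e" by auto
  then have "f \<in> out_arcs E (head E e)" using E.crossing_arcs_not_cyclic by auto
  then have out: "out_arcs E (head E e) \<noteq> {}" by blast
  have other: "\<exists>e'\<in>arcs E. e' \<noteq> e \<and> head E e' = head E e" using ee eE by auto
  obtain F x c where "detaching E F e x c"
    by (rule detaching_exists[OF fin eE(1,2) other out])
  then interpret detaching E F e x c .
  have "x \<notin> crossing_interior E"
    using x_new E.crossing_arcs_not_cyclic by (auto simp: crossing_interior_def)
  then show ?thesis
    using crossings_bij[OF w] crossing_project[OF w]
      crossing_interior_grow[OF w ee(1-4)] in_splitting_F fin_digraph_F connected_F[OF con] same_cycles_F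
    by (intro exI[of _ F] exI[of _ "map pra"]) (auto simp: graph_step_def splitting_step_def)
qed

lemma graph_step_transpose:
  assumes "graph_step (transpose_digraph E) (transpose_digraph F)" "wf_digraph E"
  shows "graph_step E F"
proof -
  have "wf_digraph F" using assms fin_digraph_def unfolding graph_step_def by auto
  then show ?thesis
    using assms same_cycles_transpose unfolding graph_step_def splitting_step_def out_splitting_def by auto
qed

lemma push_start:
  fixes E :: "(nat,nat) pre_digraph"
  assumes fin: "fin_digraph E" and con: "Digraph_Component.connected E"
    and e: "e \<in> crossing_arcs E" and w: "tail E e \<in> cyclic_verts E"
  shows "\<exists>F. graph_step E F \<and> (\<forall>u p v. crossing F u p v \<longrightarrow>
      crossing E u p v \<and> e \<notin> set p \<or>
      (\<exists>\<alpha>. crossing E (tail E e) \<alpha> v \<and> hd \<alpha> = e \<and>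
        ((\<exists>f\<in>cyclic_arcs E. head E f = tail E e \<and> tail E f = u \<and> length p = Suc (length \<alpha>)) \<or>
         (\<exists>\<beta>. crossing E u \<beta> (tail E e) \<and> length p = length \<alpha> + length \<beta>))))"
proof -
  interpret E: fin_digraph E by (rule fin)
  let ?E = "transpose_digraph E"
  have T: "fin_digraph ?E" "Digraph_Component.connected ?E" "e \<in> crossing_arcs ?E"
    "head ?E e \<in> cyclic_verts ?E"
    using fin con e w by simp_all
  obtain F' where F': "graph_step ?E F'"
    "\<forall>u p v. crossing F' u p v \<longrightarrow>
      crossing ?E u p v \<and> e \<notin> set p \<or>
      (\<exists>\<alpha>. crossing ?E u \<alpha> (tail E e) \<and> last \<alpha> = e \<and>
        ((\<exists>f\<in>cyclic_arcs E. head E f = tail E e \<and> tail E f = v \<and> length p = Suc (length \<alpha>)) \<or>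
         (\<exists>\<beta>. crossing ?E (tail E e) \<beta> v \<and> length p = length \<alpha> + length \<beta>)))"
    using push_end[OF T] unfolding transpose_simps E.cyclic_arcs_transpose by blast
  define F where "F = transpose_digraph F'"
  have step: "graph_step E F"
    by (rule graph_step_transpose) (use F'(1) E.wf_digraph in \<open>simp_all add: F_def\<close>)
  then interpret F: fin_digraph F by (simp add: graph_step_def)
  show ?thesis
  proof (intro exI[of _ F] conjI allI impI step)
    fix u p v assume "crossing F u p v"
    then have "crossing F' v (rev p) u" using F.crossing_transpose by (simp add: F_def)
    from F'(2)[rule_format, OF this]
    show "crossing E u p v \<and> e \<notin> set p \<or>
      (\<exists>\<alpha>. crossing E (tail E e) \<alpha> v \<and> hd \<alpha> = e \<and>
        ((\<exists>f\<in>cyclic_arcs E. head E f = tail E e \<and> tail E f = u \<and> length p = Suc (length \<alpha>)) \<or>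
         (\<exists>\<beta>. crossing E u \<beta> (tail E e) \<and> length p = length \<alpha> + length \<beta>)))"
    proof (elim disjE exE conjE)
      assume "crossing ?E v (rev p) u" "e \<notin> set (rev p)"
      then show ?thesis using E.crossing_transpose by simp
    next
      fix \<alpha> assume \<alpha>: "crossing ?E v \<alpha> (tail E e)" "last \<alpha> = e"
      then have "crossing E (tail E e) (rev \<alpha>) v" "hd (rev \<alpha>) = e"
        using E.crossing_transpose[of v "rev \<alpha>" "tail E e"] by (auto simp: hd_rev)
      moreover assume "\<exists>f\<in>cyclic_arcs E. head E f = tail E e \<and> tail E f = u \<and> length (rev p) = Suc (length \<alpha>)"
      ultimately show ?thesis by (intro disjI2 exI[of _ "rev \<alpha>"]) auto
    next
      fix \<alpha> \<beta> assume \<alpha>: "crossing ?E v \<alpha> (tail E e)" "last \<alpha> = e"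
      then have "crossing E (tail E e) (rev \<alpha>) v" "hd (rev \<alpha>) = e"
        using E.crossing_transpose[of v "rev \<alpha>" "tail E e"] by (auto simp: hd_rev)
      moreover assume "crossing ?E (tail E e) \<beta> u" "length (rev p) = length \<alpha> + length \<beta>"
      moreover from this(1) have "crossing E u (rev \<beta>) (tail E e)"
        using E.crossing_transpose[of "tail E e" "rev \<beta>" u] by auto
      ultimately show ?thesis by (intro disjI2 exI[of _ "rev \<alpha>"] conjI exI[of _ "rev \<beta>"]) auto
    qed
  qed
qed

lemma separate_tails:
  fixes E :: "(nat,nat) pre_digraph"
  assumes fin: "fin_digraph E" and con: "Digraph_Component.connected E"
    and e: "e \<in> crossing_arcs E" "e' \<in> crossing_arcs E" "e' \<noteq> e" "tail E e' = tail E e"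
    and w: "tail E e \<notin> cyclic_verts E"
  shows "\<exists>F h. graph_step E F \<and> bij_betw h (crossings F) (crossings E) \<and>
    (\<forall>u p v. crossing F u p v \<longrightarrow> crossing E u (h p) v \<and> length (h p) = length p) \<and>
    crossing_interior E \<subset> crossing_interior F"
proof -
  interpret E: fin_digraph E by (rule fin)
  let ?E = "transpose_digraph E"
  have T: "fin_digraph ?E" "Digraph_Component.connected ?E" "e \<in> crossing_arcs ?E"
    "e' \<in> crossing_arcs ?E" "e' \<noteq> e" "head ?E e' = head ?E e" "head ?E e \<notin> cyclic_verts ?E"
    using fin con e w by simp_all
  obtain F' h where F': "graph_step ?E F'" "bij_betw h (crossings F') (crossings ?E)"
    "\<forall>u p v. crossing F' u p v \<longrightarrow> crossing ?E u (h p) v \<and> length (h p) = length p"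
    "crossing_interior E \<subset> crossing_interior F'"
    using separate_heads[OF T] unfolding E.crossing_interior_transpose by blast
  define F where "F = transpose_digraph F'"
  have step: "graph_step E F"
    by (rule graph_step_transpose) (use F'(1) E.wf_digraph in \<open>simp_all add: F_def\<close>)
  then interpret F: fin_digraph F by (simp add: graph_step_def)
  have T': "F' = transpose_digraph F" by (simp add: F_def)
  show ?thesis
  proof (intro exI[of _ F] exI[of _ "\<lambda>p. rev (h (rev p))"] conjI allI impI step)
    have r: "bij_betw rev A (rev ` A)" for A :: "nat list set" by (simp add: bij_betw_def)
    have r': "bij_betw rev (rev ` A) A" for A :: "nat list set" using r[of "rev ` A"] by (simp add: image_image)
    have "bij_betw (rev \<circ> (h \<circ> rev)) (crossings F) (crossings E)"
      using bij_betw_trans[OF bij_betw_trans[OF r[of "crossings F"] F'(2)[unfolded T' F.crossings_transpose]]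
          r'[of "crossings E", folded E.crossings_transpose]] by (simp add: o_assoc)
    then show "bij_betw (\<lambda>p. rev (h (rev p))) (crossings F) (crossings E)" by (simp add: o_def)
    show "crossing_interior E \<subset> crossing_interior F" using F'(4) by (simp add: T')
    fix u p v assume "crossing F u p v"
    then have "crossing F' v (rev p) u" using F.crossing_transpose by (simp add: T')
    then have h: "crossing ?E v (h (rev p)) u \<and> length (h (rev p)) = length (rev p)" using F'(3) by blast
    then show "crossing E u (rev (h (rev p))) v"
      using E.crossing_transpose[of v "rev (h (rev p))" u] by simp
    show "length (rev (h (rev p))) = length p" using h by simp
  qed
qed

section \<open>Separated graphs\<close>

text \<open>
  At each interior vertex the crossings leave no choice, neither forward nor backward.  The
  condition refers to arcs of crossings only: an interior vertex may carry further arcs that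
  come from a source or lead to a sink.
\<close>

definition separated :: "('a,'b) pre_digraph \<Rightarrow> bool" where
  "separated E \<longleftrightarrow> (\<forall>a\<in>crossing_arcs E. \<forall>b\<in>crossing_arcs E.
     (head E a = head E b \<and> head E a \<notin> cyclic_verts E \<or>
      tail E a = tail E b \<and> tail E a \<notin> cyclic_verts E) \<longrightarrow> a = b)"

lemma (in wf_digraph) separated_transpose: "separated G \<Longrightarrow> separated (transpose_digraph G)"
  unfolding separated_def crossing_arcs_transpose cyclic_verts_transpose transpose_simps by blast

lemma (in wf_digraph) separated_suffix:
  assumes "separated G"
  shows "crossing G u (p1 @ b # p2) v \<Longrightarrow> crossing G u' (q1 @ b # q2) v' \<Longrightarrow> p2 = q2"
proof (induction p2 arbitrary: p1 q1 b q2)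
  case Nil
  then show ?case using crossing_split(2) by blast
next
  case (Cons a p3)
  note p = crossing_split[OF Cons.prems(1)] and q = crossing_split[OF Cons.prems(2)]
  from p(2) have hb: "head G b \<notin> cyclic_verts G" by simp
  with q(2) obtain a' q3 where q2: "q2 = a' # q3" by (cases q2) auto
  have "tail G a = head G b" "tail G a' = head G b"
    using p(7) q(7) q2 by (auto simp: awalk_Cons_iff)
  moreover have "a \<in> crossing_arcs G" "a' \<in> crossing_arcs G"
    using crossing_arcsI[OF Cons.prems(1)] crossing_arcsI[OF Cons.prems(2)] q2 by auto
  ultimately have "a = a'" using assms hb unfolding separated_def by metis
  with Cons.IH[of "p1 @ [b]" a "q1 @ [b]" q3] Cons.prems q2 show ?case by simp
qed

lemma (in wf_digraph) separated_prefix: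
  assumes "separated G"
    and "crossing G u (p1 @ b # p2) v" "crossing G u' (q1 @ b # q2) v'"
  shows "p1 = q1"
proof -
  interpret T: wf_digraph "transpose_digraph G" using wf_digraph by simp
  have "crossing (transpose_digraph G) v (rev p2 @ b # rev p1) u"
    "crossing (transpose_digraph G) v' (rev q2 @ b # rev q1) u'"
    using assms(2,3) crossing_transpose[of v "p1 @ b # p2" u] crossing_transpose[of v' "q1 @ b # q2" u']
    by simp_all
  with T.separated_suffix[OF separated_transpose[OF assms(1)]] have "rev p1 = rev q1" by blast
  then show ?thesis by simp
qed

lemma (in wf_digraph) separated_last:
  assumes "separated G" "crossing G u p v" "crossing G u' q v'" "last p = last q"
  shows "p = q"
proof -
  have "p \<noteq> []" "q \<noteq> []" using assms by (auto simp: crossing_def)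
  then obtain p' q' a where "p = p' @ [a]" "q = q' @ [a]"
    using assms(4) by (cases p rule: rev_cases; cases q rule: rev_cases) auto
  then show ?thesis using separated_prefix[OF assms(1), of u p' a "[]" v u' q' "[]" v'] assms(2,3) by simp
qed

lemma (in wf_digraph) separated_hd:
  assumes "separated G" "crossing G u p v" "crossing G u' q v'" "hd p = hd q"
  shows "p = q"
proof -
  have "p \<noteq> []" "q \<noteq> []" using assms by (auto simp: crossing_def)
  then obtain p' q' a where "p = a # p'" "q = a # q'"
    using assms(4) by (cases p; cases q) auto
  then show ?thesis using separated_suffix[OF assms(1), of u "[]" a p' v u' "[]" q' v'] assms(2,3) by simp
qed

lemma (in wf_digraph) interior_vert_head:
  assumes "crossing G u p v" "x \<in> interior_verts G p"
  obtains xs a ys where "p = xs @ a # ys" "head G a = x" "x \<notin> cyclic_verts G"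
proof -
  have x: "x \<notin> cyclic_verts G" using assms by (auto simp: interior_verts_def)
  consider a where "a \<in> set p" "head G a = x" | a where "a \<in> set p" "tail G a = x"
    using assms by (auto simp: interior_verts_def)
  then show thesis
  proof cases
    case 1
    then obtain xs ys where "p = xs @ a # ys" by (meson split_list)
    with 1 x that show thesis by blast
  next
    case 2
    then obtain xs ys where p: "p = xs @ a # ys" by (meson split_list)
    then have "xs \<noteq> []" "awalk u xs x"
      using crossing_split(1,6)[of u xs a ys v] assms(1) 2 x by auto
    then have "p = butlast xs @ last xs # a # ys" "head G (last xs) = x"
      using awalk_hd_last p by auto
    with x that show thesis by blast
  qed
qed

lemma (in wf_digraph) separated_interiors:
  assumes "separated G" "p \<in> crossings G" "q \<in> crossings G"
    "x \<in> interior_verts G p" "x \<in> interior_verts G q"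
  shows "p = q"
proof -
  obtain u v u' v' where c: "crossing G u p v" "crossing G u' q v'"
    using assms(2,3) by (auto simp: crossings_def)
  obtain xs a ys where p: "p = xs @ a # ys" "head G a = x" "x \<notin> cyclic_verts G"
    using c(1) assms(4) by (rule interior_vert_head)
  obtain xs' b ys' where q: "q = xs' @ b # ys'" "head G b = x"
    using c(2) assms(5) by (rule interior_vert_head)
  have "a \<in> crossing_arcs G" "b \<in> crossing_arcs G"
    using crossing_arcsI[OF c(1)] crossing_arcsI[OF c(2)] p q by auto
  with assms(1) p q have "a = b" unfolding separated_def by metis
  then show ?thesis
    using separated_prefix[OF assms(1), of u xs a ys v u' xs' ys' v']
      separated_suffix[OF assms(1), of u xs a ys v u' xs' ys' v'] c p q by simp
qed

definition graph_steps :: "(nat,nat) pre_digraph \<Rightarrow> (nat,nat) pre_digraph \<Rightarrow> bool" where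
  "graph_steps E F \<longleftrightarrow> splitting_step\<^sup>*\<^sup>* E F \<and> fin_digraph F \<and> Digraph_Component.connected F \<and> same_cycles E F"

lemma graph_steps_trans: "graph_steps E F \<Longrightarrow> graph_steps F H \<Longrightarrow> graph_steps E H"
  unfolding graph_steps_def using same_cycles_trans by (meson rtranclp_trans)

lemma graph_step_steps: "graph_step E F \<Longrightarrow> graph_steps E F"
  unfolding graph_steps_def graph_step_def by blast

definition same_crossings :: "('a,'b) pre_digraph \<Rightarrow> ('a,'b) pre_digraph \<Rightarrow> bool" where
  "same_crossings F E \<longleftrightarrow> (\<exists>h. bij_betw h (crossings F) (crossings E) \<and>
     (\<forall>u p v. crossing F u p v \<longrightarrow> crossing E u (h p) v \<and> length (h p) = length p))"

lemma same_crossings_refl: "same_crossings E E"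
  unfolding same_crossings_def by (intro exI[of _ id]) auto

lemma same_crossings_trans:
  assumes "same_crossings H F" "same_crossings F E"
  shows "same_crossings H E"
proof -
  obtain h k where h: "bij_betw h (crossings H) (crossings F)"
      "\<forall>u p v. crossing H u p v \<longrightarrow> crossing F u (h p) v \<and> length (h p) = length p"
    and k: "bij_betw k (crossings F) (crossings E)"
      "\<forall>u p v. crossing F u p v \<longrightarrow> crossing E u (k p) v \<and> length (k p) = length p"
    using assms unfolding same_crossings_def by metis
  have "crossing E u (k (h p)) v \<and> length (k (h p)) = length p" if "crossing H u p v" for u p v
    using h(2) k(2) that by metis
  with bij_betw_trans[OF h(1) k(1)] show ?thesis
    unfolding same_crossings_def by (intro exI[of _ "k \<circ> h"]) auto
qed

lemma same_crossings_sum: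
  assumes "same_crossings F E"
  shows "(\<Sum>p\<in>crossings F. length p) = (\<Sum>p\<in>crossings E. length p)"
proof -
  obtain h where h: "bij_betw h (crossings F) (crossings E)"
    "\<forall>u p v. crossing F u p v \<longrightarrow> crossing E u (h p) v \<and> length (h p) = length p"
    using assms unfolding same_crossings_def by metis
  have "(\<Sum>p\<in>crossings F. length p) = (\<Sum>p\<in>crossings F. length (h p))"
    by (rule sum.cong[OF refl]) (use h(2) in \<open>auto simp: crossings_def\<close>)
  also have "\<dots> = (\<Sum>p\<in>crossings E. length p)" by (rule sum.reindex_bij_betw[OF h(1)])
  finally show ?thesis .
qed

lemma (in fin_digraph) card_crossing_interior:
  "finite (crossing_interior G)" "card (crossing_interior G) \<le> (\<Sum>p\<in>crossings G. length p)"
proof -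
  have fin: "finite (crossing_arcs G)" by (simp add: crossing_arcs_def finite_crossings)
  then show "finite (crossing_interior G)" by (simp add: crossing_interior_def)
  have "card (crossing_interior G) \<le> card (head G ` crossing_arcs G)"
    using fin by (intro card_mono) (auto simp: crossing_interior_def)
  also have "\<dots> \<le> card (crossing_arcs G)" using fin by (rule card_image_le)
  also have "\<dots> \<le> (\<Sum>p\<in>crossings G. card (set p))"
    unfolding crossing_arcs_def by (rule card_UN_le[OF finite_crossings])
  also have "\<dots> \<le> (\<Sum>p\<in>crossings G. length p)" by (intro sum_mono card_length)
  finally show "card (crossing_interior G) \<le> (\<Sum>p\<in>crossings G. length p)" .
qed

text \<open>
  As long as the graph is not separated, a move at a shared interior vertex is available.  The
  number of interior vertices grows with each such move, but never exceeds the sum of the lengths of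
  the crossings, which the moves preserve.
\<close>
lemma separation:
  assumes "fin_digraph E" "Digraph_Component.connected E"
  shows "\<exists>F. graph_steps E F \<and> separated F \<and> same_crossings F E"
  using assms
proof (induction "(\<Sum>p\<in>crossings E. length p) - card (crossing_interior E)" arbitrary: E rule: less_induct)
  case less
  interpret fin_digraph E by (rule less.prems)
  show ?case
  proof (cases "separated E")
    case True
    then show ?thesis
      using less.prems same_crossings_refl by (intro exI[of _ E]) (simp add: graph_steps_def)
  next
    case False
    then obtain a b where ab: "a \<in> crossing_arcs E" "b \<in> crossing_arcs E" "b \<noteq> a"
      "head E b = head E a \<and> head E a \<notin> cyclic_verts E \<or> tail E b = tail E a \<and> tail E a \<notin> cyclic_verts E"
      unfolding separated_def by metis
    then obtain F h where F: "graph_step E F" "bij_betw h (crossings F) (crossings E)"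
      "\<forall>u p v. crossing F u p v \<longrightarrow> crossing E u (h p) v \<and> length (h p) = length p"
      "crossing_interior E \<subset> crossing_interior F"
      using separate_heads[OF less.prems ab(1-3)] separate_tails[OF less.prems ab(1-3)] by blast
    then have F': "fin_digraph F" "Digraph_Component.connected F" "same_crossings F E"
      unfolding graph_step_def same_crossings_def by blast+
    have "card (crossing_interior E) < card (crossing_interior F)"
      using F(4) fin_digraph.card_crossing_interior(1)[OF F'(1)] by (rule psubset_card_mono[rotated])
    then have "(\<Sum>p\<in>crossings F. length p) - card (crossing_interior F)
        < (\<Sum>p\<in>crossings E. length p) - card (crossing_interior E)"
      using fin_digraph.card_crossing_interior(2)[OF F'(1)] same_crossings_sum[OF F'(3)] by linarith
    from less.hyps[OF this F'(1,2)] obtain H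
      where "graph_steps F H" "separated H" "same_crossings H F" by blast
    then show ?thesis
      using graph_steps_trans[OF graph_step_steps[OF F(1)]] same_crossings_trans F'(3) by blast
  qed
qed

section \<open>Arithmetic of phases\<close>

text \<open>Solve \<open>j * b = n\<close> modulo \<open>a\<close> with \<open>j < a\<close>; then \<open>j * b\<close> does not exceed \<open>a * b\<close>.\<close>
lemma gcd_multiple_representable:
  fixes a b n :: nat
  assumes "gcd a b dvd n" "a * b \<le> n" "a > 0" "b > 0"
  obtains i j where "n = i * a + j * b"
proof -
  obtain j0 where "[b * j0 = n] (mod a)"
    using cong_solve_nat[of b a] assms by (metis cong_solve_dvd_nat gcd.commute less_numeral_extra(3))
  define j where "j = j0 mod a"
  have j: "[b * j = n] (mod a)" "j < a"
    using \<open>[b * j0 = n] (mod a)\<close> assms(3) by (auto simp: j_def cong_def mod_mult_right_eq)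
  have "b * j \<le> a * b" using j(2) by simp
  then have "b * j \<le> n" using assms(2) by linarith
  then have "a dvd n - b * j" using j(1) by (metis cong_sym cong_altdef_nat)
  then obtain i where "n - b * j = a * i" by (elim dvdE)
  then have "n = i * a + j * b" using \<open>b * j \<le> n\<close> by (simp add: mult.commute)
  then show thesis by (rule that)
qed

text \<open>
  The residue classes of \<open>x\<close> and \<open>y\<close> contain \<open>p\<close> and \<open>b - q\<close>.  Raise the rest of \<open>r\<close> to the next
  multiple of the gcd and distribute it as multiples of \<open>a\<close> and \<open>b\<close>.
\<close>
lemma phase_representable:
  fixes a b r p q :: nat
  assumes "p < a" "q < b" "a + b + a * b \<le> r"
  shows "\<exists>x y t. t < gcd a b \<and> x + y = r + t \<and> [x = p] (mod a) \<and> [y + q = 0] (mod b)"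
proof -
  define g where "g = gcd a b"
  define s where "s = r - p - (b - q)"
  define t where "t = (g - s mod g) mod g"
  have g: "g > 0" using assms by (simp add: g_def)
  have s: "s + p + (b - q) = r" "a * b \<le> s" using assms by (auto simp: s_def)
  have t: "t < g" using g by (simp add: t_def)
  have "(s + t) mod g = (s mod g + (g - s mod g)) mod g"
    by (simp add: t_def mod_simps)
  also have "s mod g + (g - s mod g) = g" using g by (simp add: less_imp_le_nat)
  finally have "g dvd s + t" by (simp add: dvd_eq_mod_eq_0)
  then obtain i j where ij: "s + t = i * a + j * b"
    using gcd_multiple_representable[of a b "s + t"] s assms by (auto simp: g_def)
  have "(p + i * a) + ((b - q) + j * b) = r + t" using ij s by linarith
  moreover have "[p + i * a = p] (mod a)" by (simp add: cong_def)
  moreover have "b - q + j * b + q = (j + 1) * b" using assms by simp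
  then have "[(b - q) + j * b + q = 0] (mod b)" by (simp add: cong_0_iff del: mult_Suc)
  ultimately show ?thesis using t unfolding g_def by blast
qed

text \<open>
  The shape in which the multiset order is used below: \<open>a\<close> is lost, and whatever is not inherited
  from \<open>A\<close> unchanged lies below \<open>a\<close>.
\<close>
lemma mset_replace_mult:
  assumes fin: "finite A" "finite B" and a: "a \<in> A"
    and B: "\<And>p. p \<in> B \<Longrightarrow> p \<in> A - {a} \<and> f p = g p \<or> (f p, g a) \<in> r"
  shows "(image_mset f (mset_set B), image_mset g (mset_set A)) \<in> mult r"
proof -
  define O' where "O' = {p \<in> B. p \<in> A - {a} \<and> f p = g p}"
  have "B = O' \<union> (B - O')" "A = O' \<union> (A - O')" by (auto simp: O'_def)
  then have *: "mset_set B = mset_set O' + mset_set (B - O')" "mset_set A = mset_set O' + mset_set (A - O')"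
    using fin by (metis Diff_disjoint finite_Un mset_set_Union)+
  have same: "image_mset f (mset_set O') = image_mset g (mset_set O')"
    by (rule image_mset_cong) (use fin in \<open>auto simp: O'_def\<close>)
  have "a \<in> A - O'" using a by (auto simp: O'_def)
  then have ga: "g a \<in># image_mset g (mset_set (A - O'))" using fin by simp
  have "(f p, g a) \<in> r" if "p \<in> B - O'" for p
    using B[of p] that by (auto simp: O'_def)
  then have "\<forall>k\<in>#image_mset f (mset_set (B - O')). \<exists>j\<in>#image_mset g (mset_set (A - O')). (k, j) \<in> r"
    using ga fin(2) by fastforce
  moreover have "image_mset g (mset_set (A - O')) \<noteq> {#}"
    using ga by (metis empty_iff set_mset_empty)
  ultimately show ?thesis
    unfolding * image_mset_union same by (intro one_step_implies_mult)
qed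

section \<open>Positions and levels on disjoint cycles\<close>

lemma cycles_obtain:
  assumes "C \<in> cycles E"
  obtains p where "pre_digraph.cycle E p" "C = rotations p"
  using assms unfolding cycles_def by (rule imageE) (use that in simp)

lemma cycle_length_rotations: "cycle_length (rotations p) = length p"
  unfolding cycle_length_def
proof (rule the_equality)
  show "\<forall>q\<in>rotations p. length q = length p" by (auto simp: rotations_def)
  show "n = length p" if "\<forall>q\<in>rotations p. length q = n" for n
    using bspec[OF that rotations_self] by simp
qed

locale disjoint_cycle_graph = fin_digraph G for G :: "('a,'b) pre_digraph" (structure) +
  assumes disjoint: "disjoint_cycles G"
begin

lemma cycle_unique:
  assumes "cycle p" "cycle q" "v \<in> tail G ` set p" "v \<in> tail G ` set q"
  shows "rotations p = rotations q"
proof -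
  obtain e f where ef: "e \<in> set p" "tail G e = v" "f \<in> set q" "tail G f = v" using assms by auto
  obtain p' where p': "rotations p' = rotations p" "cycle p'" "hd p' = e"
    using cycle_through[OF assms(1) ef(1)] by metis
  obtain q' where q': "rotations q' = rotations q" "cycle q'" "hd q' = f"
    using cycle_through[OF assms(2) ef(3)] by metis
  have "cycle_at G v p'" "cycle_at G v q'" using p' q' ef by (simp_all add: cycle_at_iff)
  then have "p' = q'" using disjoint unfolding disjoint_cycles_def by blast
  with p' q' show ?thesis by simp
qed

lemma cycle_verts_unique:
  assumes "C \<in> cycles G" "D \<in> cycles G" "v \<in> cycle_verts G C" "v \<in> cycle_verts G D"
  shows "C = D"
proof -
  obtain p where p: "cycle p" "C = rotations p" using assms(1) by (rule cycles_obtain)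
  obtain q where q: "cycle q" "D = rotations q" using assms(2) by (rule cycles_obtain)
  show ?thesis
    unfolding p(2) q(2)
    by (rule cycle_unique[of p q v]) (use assms(3,4) p q in \<open>simp_all add: cycle_verts_rotations\<close>)
qed

definition cyc :: "'a \<Rightarrow> 'b list set" where
  "cyc v = (THE C. C \<in> cycles G \<and> v \<in> cycle_verts G C)"

lemma cyc_eqI: "C \<in> cycles G \<Longrightarrow> v \<in> cycle_verts G C \<Longrightarrow> cyc v = C"
  unfolding cyc_def using cycle_verts_unique by (intro the_equality) auto

lemma cyc_mem:
  assumes "v \<in> cyclic_verts G"
  shows "cyc v \<in> cycles G" "v \<in> cycle_verts G (cyc v)"
proof -
  obtain C where "C \<in> cycles G" "v \<in> cycle_verts G C" using assms by (auto simp: cyclic_verts_def)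
  with cyc_eqI show "cyc v \<in> cycles G" "v \<in> cycle_verts G (cyc v)" by auto
qed

text \<open>The first arc of \<open>base C\<close> starts at the vertex of position 0, the distinguished vertex of \<open>C\<close>.\<close>
definition base :: "'b list set \<Rightarrow> 'b list" where "base C = (SOME p. p \<in> C)"

lemma base:
  assumes "C \<in> cycles G"
  shows "cycle (base C)" "C = rotations (base C)" "cycle_length C = length (base C)" "base C \<in> C"
proof -
  obtain p where p: "cycle p" "C = rotations p" using assms by (rule cycles_obtain)
  show "base C \<in> C" unfolding base_def using rotations_self[of p] p by (metis someI)
  then obtain k where "base C = rotate k p" using p by (auto simp: rotations_def)
  with p show "cycle (base C)" "C = rotations (base C)"
    using cycle_rotate rotations_rotate by metis+
  show "cycle_length C = length (base C)"
    using p(2) cycle_length_rotations[of p] \<open>base C = rotate k p\<close> by simp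
qed

lemma cycle_verts_base: "C \<in> cycles G \<Longrightarrow> cycle_verts G C = tail G ` set (base C)"
  using base(2) cycle_verts_rotations by metis

definition len :: "'a \<Rightarrow> nat" where "len v = length (base (cyc v))"
definition pos :: "'a \<Rightarrow> nat" where
  "pos v = (THE i. i < length (base (cyc v)) \<and> tail G (base (cyc v) ! i) = v)"

lemma pos_eqI:
  assumes "C \<in> cycles G" "i < length (base C)"
  shows "pos (tail G (base C ! i)) = i" "cyc (tail G (base C ! i)) = C"
    "len (tail G (base C ! i)) = length (base C)"
proof -
  show c: "cyc (tail G (base C ! i)) = C"
    by (rule cyc_eqI) (use assms cycle_verts_base in auto)
  then show "len (tail G (base C ! i)) = length (base C)" by (simp add: len_def)
  have "distinct (map (tail G) (base C))" using base(1)[OF assms(1)] by (simp add: cycle_iff_rotate1)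
  then have "k = i" if "k < length (base C)" "tail G (base C ! k) = tail G (base C ! i)" for k
    using nth_eq_iff_index_eq[of "map (tail G) (base C)" k i] that assms(2) by simp
  then show "pos (tail G (base C ! i)) = i"
    unfolding pos_def c using assms(2) by (intro the_equality) blast+
qed

lemma cyclic_vert_nth:
  assumes "v \<in> cyclic_verts G"
  shows "pos v < len v" "tail G (base (cyc v) ! pos v) = v"
proof -
  have "v \<in> tail G ` set (base (cyc v))" using cyc_mem[OF assms] cycle_verts_base by metis
  then obtain i where i: "i < length (base (cyc v))" "tail G (base (cyc v) ! i) = v"
    by (metis imageE in_set_conv_nth)
  then have "pos v = i" using pos_eqI(1)[OF cyc_mem(1)[OF assms] i(1)] by simp
  with i show "pos v < len v" "tail G (base (cyc v) ! pos v) = v"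
    by (simp_all add: len_def)
qed

lemma cycle_length_cyc: "v \<in> cyclic_verts G \<Longrightarrow> cycle_length (cyc v) = len v"
  unfolding len_def by (rule base(3)[OF cyc_mem(1)])

lemma pos_inj:
  assumes "u \<in> cyclic_verts G" "v \<in> cyclic_verts G" "cyc u = cyc v" "pos u = pos v"
  shows "u = v"
  using cyclic_vert_nth(2)[OF assms(1)] cyclic_vert_nth(2)[OF assms(2)] assms(3,4) by metis

lemma pos_0_exists:
  assumes "C \<in> cycles G"
  obtains v where "v \<in> cycle_verts G C" "pos v = 0"
proof -
  have "0 < length (base C)" using base(1)[OF assms] by (simp add: cycle_iff_rotate1)
  then show thesis
    using that[of "tail G (base C ! 0)"] pos_eqI(1)[OF assms] cycle_verts_base[OF assms] by auto
qed

lemma cyclic_arc_next: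
  assumes "f \<in> cyclic_arcs G"
  shows "cyc (head G f) = cyc (tail G f)" "len (head G f) = len (tail G f)"
    "pos (head G f) = Suc (pos (tail G f)) mod len (tail G f)"
proof -
  obtain p where p: "cycle p" "f \<in> set p" using assms by (auto simp: cyclic_arcs_def)
  define C where "C = rotations p"
  have C: "C \<in> cycles G" using p by (auto simp: C_def cycles_def)
  have "set (base C) = set p" using base(4)[OF C] set_rotations unfolding C_def by blast
  then have "f \<in> set (base C)" using p(2) by simp
  then obtain i where i: "i < length (base C)" "f = base C ! i" by (metis in_set_conv_nth)
  have "map (head G) (base C) ! i = rotate1 (map (tail G) (base C)) ! i"
    using base(1)[OF C] by (simp add: cycle_iff_rotate1)
  moreover have j: "Suc i mod length (base C) < length (base C)"
    by (rule mod_less_divisor) (use i in linarith)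
  ultimately have h: "head G f = tail G (base C ! (Suc i mod length (base C)))"
    using i by (simp add: nth_rotate1 del: mod_less)
  show "cyc (head G f) = cyc (tail G f)" "len (head G f) = len (tail G f)"
    "pos (head G f) = Suc (pos (tail G f)) mod len (tail G f)"
    using pos_eqI[OF C i(1)] pos_eqI[OF C j] h i(2) by simp_all
qed

text \<open>
  Any function would do that is constant on cycles and decreases along crossings; the number of
  reachable vertices is one, because the start of a crossing cannot be reached from its end.
\<close>
definition lev :: "'a \<Rightarrow> nat" where "lev v = card {y. v \<rightarrow>\<^sup>* y}"

lemma finite_reach: "finite {y. v \<rightarrow>\<^sup>* y}"
  by (rule finite_subset[OF _ finite_verts]) (use reachable_in_verts in auto)

lemma lev_le: "lev v \<le> card (verts G)"
  unfolding lev_def by (rule card_mono) (use reachable_in_verts in auto)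

lemma lev_cyclic_arc:
  assumes "f \<in> cyclic_arcs G"
  shows "lev (head G f) = lev (tail G f)"
proof -
  have "head G f \<rightarrow>\<^sup>* tail G f" using assms cyclic_arcs_iff by blast
  moreover have "tail G f \<rightarrow>\<^sup>* head G f"
    using assms cyclic_arcs_iff[of f] in_arcs_imp_in_arcs_ends by blast
  ultimately have "{y. head G f \<rightarrow>\<^sup>* y} = {y. tail G f \<rightarrow>\<^sup>* y}"
    using reachable_trans by blast
  then show ?thesis by (simp add: lev_def)
qed

lemma lev_crossing:
  assumes "crossing G u p v"
  shows "lev v < lev u"
proof -
  have p: "awalk u p v" "p \<noteq> []" "set p \<inter> cyclic_arcs G = {}" using assms by (auto simp: crossing_def)
  then have uv: "u \<rightarrow>\<^sup>* v" by (auto simp: reachable_awalk)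
  have "\<not> v \<rightarrow>\<^sup>* u"
  proof
    assume "v \<rightarrow>\<^sup>* u"
    then obtain q where "awalk v q u" by (auto simp: reachable_awalk)
    then have "awalk u (p @ q) u" using p awalk_appendI by blast
    then have "hd p \<in> cyclic_arcs G" using closed_walk_cyclic[of u "p @ q" "hd p"] p by simp
    then show False using p(2,3) hd_in_set[of p] by blast
  qed
  moreover have "u \<rightarrow>\<^sup>* u" by (rule reachable_refl[OF awalk_hd_in_verts[OF p(1)]])
  moreover have "{y. v \<rightarrow>\<^sup>* y} \<subseteq> {y. u \<rightarrow>\<^sup>* y}" using reachable_trans[OF uv] by blast
  ultimately have "{y. v \<rightarrow>\<^sup>* y} \<subset> {y. u \<rightarrow>\<^sup>* y}" by blast
  then show ?thesis unfolding lev_def using finite_reach by (intro psubset_card_mono) auto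
qed

end

section \<open>The schedule\<close>

text \<open>
  The graph \<open>G\<close> is the one that the process starts from; positions, lengths and levels are those of
  \<open>G\<close> throughout, as all later graphs have literally the same cycles.  The bound \<open>c\<close> leaves room for
  \<open>8 * N\<close>, of which \<open>5 * N\<close> are the slack in \<open>pending\<close> and \<open>3 * N\<close> are used up by
  \<open>phase_representable\<close>.
\<close>
locale phased_graph = disjoint_cycle_graph G for G :: "(nat,nat) pre_digraph" (structure) +
  fixes N c :: nat
  assumes connected_G: "Digraph_Component.connected G"
    and N_dvd: "\<And>u v. u \<in> cyclic_verts G \<Longrightarrow> v \<in> cyclic_verts G \<Longrightarrow> len u * len v dvd N"
    and N_pos: "0 < N"
    and c: "\<And>p. p \<in> crossings G \<Longrightarrow> length p + 8 \<le> c"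
begin

text \<open>
  A crossing of length \<open>l\<close> from \<open>u\<close> to \<open>v\<close> reaches its aim after its start has been moved back \<open>x\<close>
  times and its end forward \<open>y\<close> times.  The slack \<open>5 * N\<close> makes the aim superadditive: the aim for a
  level drop \<open>d + d'\<close> exceeds the sum of those for \<open>d\<close> and \<open>d'\<close> by \<open>5 * N\<close>, of which the
  remainders \<open>t\<close> of the parts take at most \<open>2 * N\<close> and \<open>phase_representable\<close> takes \<open>3 * N\<close>.  Writing
  the slack on the left avoids truncated subtraction.
\<close>
definition pending :: "nat \<Rightarrow> nat \<Rightarrow> nat \<Rightarrow> nat \<Rightarrow> nat \<Rightarrow> bool" where
  "pending u v l x y \<longleftrightarrow> (\<exists>t < gcd (len u) (len v). x + y + l + 5 * N = N * c * (lev u - lev v) + t \<and>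
     [x = pos u] (mod len u) \<and> [y + pos v = 0] (mod len v))"

text \<open>The state of the process: no crossing has outgrown its aim or missed its residue classes.\<close>
definition invariant :: "(nat,nat) pre_digraph \<Rightarrow> bool" where
  "invariant E \<longleftrightarrow> fin_digraph E \<and> Digraph_Component.connected E \<and> same_cycles G E \<and>
     (\<forall>u p v. crossing E u p v \<longrightarrow> lev v < lev u \<and> (\<exists>x y. pending u v (length p) x y))"

lemma len_le:
  assumes "u \<in> cyclic_verts G" "v \<in> cyclic_verts G"
  shows "len u \<le> N" "len u * len v \<le> N" "0 < len u" "gcd (len u) (len v) \<le> N"
proof -
  show p: "0 < len u" using cyclic_vert_nth(1)[OF assms(1)] by linarith
  show "len u * len v \<le> N" using N_dvd[OF assms] N_pos by (rule dvd_imp_le)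
  show "len u \<le> N" using N_dvd[OF assms] N_pos by (meson dvd_imp_le dvd_mult_left)
  then show "gcd (len u) (len v) \<le> N" using p by (metis gcd_le1_nat le_trans neq0_conv)
qed

lemma pending_bound:
  assumes "u \<in> cyclic_verts G" "v \<in> cyclic_verts G" "pending u v l x y"
  shows "l + 4 * N \<le> N * c * (lev u - lev v)"
  using assms(3) len_le(4)[OF assms(1,2)] unfolding pending_def by auto

lemma pending_exists:
  assumes uv: "u \<in> cyclic_verts G" "v \<in> cyclic_verts G" and l: "l + 8 * N \<le> N * c * (lev u - lev v)"
  shows "\<exists>x y. pending u v l x y"
proof -
  define r where "r = N * c * (lev u - lev v) - l - 5 * N"
  have r: "r + l + 5 * N = N * c * (lev u - lev v)" "3 * N \<le> r" using l by (auto simp: r_def)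
  have "len u + len v + len u * len v \<le> r"
    using len_le(1,2)[OF uv] len_le(1)[OF uv(2,1)] r by linarith
  from phase_representable[OF cyclic_vert_nth(1)[OF uv(1)] cyclic_vert_nth(1)[OF uv(2)] this]
  obtain x y t where t: "t < gcd (len u) (len v)" "x + y = r + t"
    "[x = pos u] (mod len u)" "[y + pos v = 0] (mod len v)" by blast
  have "x + y + l + 5 * N = N * c * (lev u - lev v) + t" using t(2) r(1) by linarith
  with t show ?thesis unfolding pending_def by blast
qed

lemma pending_compose:
  assumes "u \<in> cyclic_verts G" "w \<in> cyclic_verts G" "v \<in> cyclic_verts G"
    and "lev w < lev u" "lev v < lev w" "pending u w a x y" "pending w v b x' y'"
  shows "\<exists>x y. pending u v (a + b) x y"
proof (rule pending_exists[OF assms(1,3)])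
  have "lev u - lev v = (lev u - lev w) + (lev w - lev v)" using assms by linarith
  then have "N * c * (lev u - lev v) = N * c * (lev u - lev w) + N * c * (lev w - lev v)"
    by (metis add_mult_distrib2)
  with pending_bound[OF assms(1,2,6)] pending_bound[OF assms(2,3,7)]
  show "a + b + 8 * N \<le> N * c * (lev u - lev v)" by linarith
qed

lemma pending_advance_end:
  assumes f: "f \<in> cyclic_arcs G" "tail G f = w" and p: "pending u w l x (Suc y)"
  shows "pending u (head G f) (Suc l) x y"
proof -
  note nx = cyclic_arc_next[OF f(1)]
  have "[Suc y + pos w = 0] (mod len w)" using p by (auto simp: pending_def)
  then have "[y + pos (head G f) = 0] (mod len w)"
    using nx(3) f(2) by (simp add: cong_def mod_simps)
  then show ?thesis
    using p nx(2) f lev_cyclic_arc[OF f(1)] by (auto simp: pending_def)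
qed

lemma pending_advance_start:
  assumes f: "f \<in> cyclic_arcs G" "head G f = w" and p: "pending w v l (Suc x) y"
  shows "pending (tail G f) v (Suc l) x y"
proof -
  note nx = cyclic_arc_next[OF f(1)]
  have "[Suc x = pos w] (mod len w)" using p by (auto simp: pending_def)
  then have "[x + 1 = pos (tail G f) + 1] (mod len (tail G f))"
    using nx f(2) by (simp add: cong_def)
  then have "[x = pos (tail G f)] (mod len (tail G f))" by (simp only: cong_add_rcancel_nat)
  then show ?thesis
    using p nx(2) f lev_cyclic_arc[OF f(1)] by (auto simp: pending_def)
qed

text \<open>
  Both components count down: a concatenation has a larger level drop, and a move
  along the cycle keeps the level drop and increases the length, which stays below its aim.
\<close>
definition weight :: "nat \<Rightarrow> nat \<Rightarrow> nat \<Rightarrow> nat \<times> nat" where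
  "weight u v l = (card (verts G) - (lev u - lev v), N * c * card (verts G) - l)"

definition weights :: "(nat,nat) pre_digraph \<Rightarrow> (nat \<times> nat) multiset" where
  "weights E = image_mset (\<lambda>p. weight (trail_source E p) (trail_range E p) (length p)) (mset_set (crossings E))"

abbreviation "wt_less \<equiv> less_than <*lex*> less_than"

lemma weight_advance:
  assumes "u' \<in> cyclic_verts G" "v' \<in> cyclic_verts G" "lev u' = lev u" "lev v' = lev v"
    "pending u' v' (Suc l) x y"
  shows "(weight u' v' (Suc l), weight u v l) \<in> wt_less"
proof -
  have "Suc l + 4 * N \<le> N * c * (lev u - lev v)" using pending_bound[OF assms(1,2,5)] assms(3,4) by simp
  also have "\<dots> \<le> N * c * card (verts G)" using lev_le[of u] by (intro mult_le_mono2) linarith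
  finally show ?thesis using assms(3,4) by (auto simp: weight_def)
qed

lemma weight_compose:
  assumes "lev u' - lev v' > lev u - lev v"
  shows "(weight u' v' l', weight u v l) \<in> wt_less"
  using assms lev_le[of u'] by (auto simp: weight_def)

lemma invariant_fin: "invariant E \<Longrightarrow> fin_digraph E" by (simp add: invariant_def)

lemma invariant_cyclic:
  assumes "invariant E"
  shows "cyclic_arcs E = cyclic_arcs G" "cyclic_verts E = cyclic_verts G"
    "f \<in> cyclic_arcs G \<Longrightarrow> tail E f = tail G f" "f \<in> cyclic_arcs G \<Longrightarrow> head E f = head G f"
proof -
  have sc: "same_cycles G E" using assms by (simp add: invariant_def)
  show "cyclic_arcs E = cyclic_arcs G" "cyclic_verts E = cyclic_verts G"
    using same_cycles_arcs[OF sc] same_cycles_verts[OF sc] by simp_all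
  show "f \<in> cyclic_arcs G \<Longrightarrow> tail E f = tail G f" "f \<in> cyclic_arcs G \<Longrightarrow> head E f = head G f"
    using sc by (simp_all add: same_cycles_def)
qed

lemma invariant_ends:
  assumes "invariant E" "crossing E u p v"
  shows "u \<in> cyclic_verts G" "v \<in> cyclic_verts G"
  using assms invariant_cyclic(2) by (auto simp: crossing_def)

lemma invariant_same_crossings:
  assumes E: "invariant E" and F: "graph_steps E F" "same_crossings F E"
  shows "invariant F" "weights F = weights E"
proof -
  obtain h where h: "bij_betw h (crossings F) (crossings E)"
    "\<forall>u p v. crossing F u p v \<longrightarrow> crossing E u (h p) v \<and> length (h p) = length p"
    using F(2) unfolding same_crossings_def by metis
  have "same_cycles G F" using same_cycles_trans E F(1) by (auto simp: invariant_def graph_steps_def)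
  moreover have "lev v < lev u \<and> (\<exists>x y. pending u v (length p) x y)" if "crossing F u p v" for u p v
    using E h(2) that unfolding invariant_def by metis
  ultimately show "invariant F" using F(1) unfolding invariant_def graph_steps_def by blast
  interpret F: fin_digraph F using F(1) by (simp add: graph_steps_def)
  interpret E: fin_digraph E using E by (rule invariant_fin)
  have "weight (trail_source F p) (trail_range F p) (length p) =
      weight (trail_source E (h p)) (trail_range E (h p)) (length (h p))"
    if pF: "p \<in> crossings F" for p
  proof -
    obtain u v where p: "crossing F u p v" using pF by (auto simp: crossings_def)
    then have "crossing E u (h p) v" "length (h p) = length p" using h(2) by blast+
    then show ?thesis using F.crossing_ends[OF p] E.crossing_ends[of u "h p" v] by simp
  qed
  then have "weights F = image_mset (\<lambda>p. weight (trail_source E p) (trail_range E p) (length p))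
      (image_mset h (mset_set (crossings F)))"
    unfolding weights_def by (auto intro!: image_mset_cong simp: F.finite_crossings multiset.map_comp)
  also have "image_mset h (mset_set (crossings F)) = mset_set (crossings E)"
    using h(1) by (simp add: bij_betw_def image_mset_mset_set)
  finally show "weights F = weights E" by (simp add: weights_def)
qed

lemma invariant_push:
  assumes E: "invariant E" and step: "graph_step E F" and \<alpha>: "crossing E a \<alpha> b"
    and F: "\<And>u p v. crossing F u p v \<Longrightarrow> crossing E u p v \<and> p \<noteq> \<alpha> \<or>
      lev v < lev u \<and> (\<exists>x y. pending u v (length p) x y) \<and>
      (weight u v (length p), weight a b (length \<alpha>)) \<in> wt_less"
  shows "invariant F" "(weights F, weights E) \<in> mult wt_less"
proof -
  have "same_cycles G F" using same_cycles_trans E step by (auto simp: invariant_def graph_step_def)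
  moreover have "lev v < lev u \<and> (\<exists>x y. pending u v (length p) x y)" if "crossing F u p v" for u p v
    using F[OF that] E unfolding invariant_def by blast
  ultimately show "invariant F" using step unfolding invariant_def graph_step_def by blast
  interpret F: fin_digraph F using step by (simp add: graph_step_def)
  interpret E: fin_digraph E using E by (rule invariant_fin)
  show "(weights F, weights E) \<in> mult wt_less"
    unfolding weights_def
  proof (rule mset_replace_mult[OF E.finite_crossings F.finite_crossings, of \<alpha>])
    show "\<alpha> \<in> crossings E" using \<alpha> by (auto simp: crossings_def)
    fix p assume "p \<in> crossings F"
    then obtain u v where p: "crossing F u p v" by (auto simp: crossings_def)
    show "p \<in> crossings E - {\<alpha>} \<and> weight (trail_source F p) (trail_range F p) (length p) =
        weight (trail_source E p) (trail_range E p) (length p) \<or>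
      (weight (trail_source F p) (trail_range F p) (length p),
       weight (trail_source E \<alpha>) (trail_range E \<alpha>) (length \<alpha>)) \<in> wt_less"
    proof (cases "crossing E u p v \<and> p \<noteq> \<alpha>")
      case True
      then have "p \<in> crossings E - {\<alpha>}" by (auto simp: crossings_def)
      with True F.crossing_ends[OF p] E.crossing_ends[of u p v] show ?thesis by simp
    next
      case False
      with F[OF p] F.crossing_ends[OF p] E.crossing_ends[OF \<alpha>] show ?thesis by simp
    qed
  qed
qed

text \<open>
  In a separated graph the first and the last arc of \<open>\<alpha>\<close> belong to no other crossing, so that a
  move at either of them affects \<open>\<alpha>\<close> alone.
\<close>
lemma advance:
  assumes E: "invariant E" "separated E" and \<alpha>: "crossing E a \<alpha> b"
    and p: "pending a b (length \<alpha>) x y" "x + y > 0"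
  shows "\<exists>F. graph_step E F \<and> invariant F \<and> (weights F, weights E) \<in> mult wt_less"
proof -
  interpret E: fin_digraph E using E(1) by (rule invariant_fin)
  have con: "Digraph_Component.connected E" using E(1) by (simp add: invariant_def)
  note Z = invariant_cyclic[OF E(1)]
  have inv: "lev v < lev u" "\<exists>x y. pending u v (length p) x y" "u \<in> cyclic_verts G" "v \<in> cyclic_verts G"
    if "crossing E u p v" for u p v
    using that E(1) invariant_ends[OF E(1) that] by (auto simp: invariant_def)
  have ne: "\<alpha> \<noteq> []" using \<alpha> by (auto simp: crossing_def)
  have ab: "tail E (hd \<alpha>) = a" "head E (last \<alpha>) = b"
    using E.crossing_ends[OF \<alpha>] by (auto simp: trail_source_def trail_range_def)
  have arcs: "hd \<alpha> \<in> crossing_arcs E" "last \<alpha> \<in> crossing_arcs E"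
    using crossing_arcsI[OF \<alpha>] ne by auto
  \<comment> \<open>Move the end forward if that is due at least once, and otherwise the start back.\<close>
  show ?thesis
  proof (cases y)
    case (Suc y')
    obtain F where F: "graph_step E F" "\<forall>u p v. crossing F u p v \<longrightarrow>
      crossing E u p v \<and> last \<alpha> \<notin> set p \<or>
      (\<exists>\<alpha>'. crossing E u \<alpha>' b \<and> last \<alpha>' = last \<alpha> \<and>
        ((\<exists>f\<in>cyclic_arcs E. tail E f = b \<and> head E f = v \<and> length p = Suc (length \<alpha>')) \<or>
         (\<exists>\<beta>. crossing E b \<beta> v \<and> length p = length \<alpha>' + length \<beta>)))"
      using push_end[OF E.fin_digraph con arcs(2)] inv(4)[OF \<alpha>] unfolding ab Z(2) by blast
    have "crossing E u p v \<and> p \<noteq> \<alpha> \<or>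
      lev v < lev u \<and> (\<exists>x y. pending u v (length p) x y) \<and>
      (weight u v (length p), weight a b (length \<alpha>)) \<in> wt_less" if pF: "crossing F u p v" for u p v
    proof (cases "crossing E u p v \<and> last \<alpha> \<notin> set p")
      case True
      then show ?thesis using ne by auto
    next
      case False
      then obtain \<alpha>' where \<alpha>': "crossing E u \<alpha>' b" "last \<alpha>' = last \<alpha>" and
        cases: "(\<exists>f\<in>cyclic_arcs E. tail E f = b \<and> head E f = v \<and> length p = Suc (length \<alpha>')) \<or>
         (\<exists>\<beta>. crossing E b \<beta> v \<and> length p = length \<alpha>' + length \<beta>)"
        using F(2) pF by blast
      have "\<alpha>' = \<alpha>" using E.separated_last[OF E(2) \<alpha>'(1) \<alpha> \<alpha>'(2)] .
      then have "u = a" using E.crossing_ends(1)[OF \<alpha>] E.crossing_ends(1)[OF \<alpha>'(1)] by simp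
      from cases show ?thesis
      proof (elim disjE bexE exE conjE)
        fix f assume f: "f \<in> cyclic_arcs E" "tail E f = b" "head E f = v" "length p = Suc (length \<alpha>')"
        have fG: "f \<in> cyclic_arcs G" "tail G f = b" "head G f = v" using f Z by auto
        have pend: "pending a v (Suc (length \<alpha>)) x y'"
          using pending_advance_end[OF fG(1,2), of a "length \<alpha>" x y'] p(1) Suc fG(3) by simp
        have lv: "lev v = lev b" using lev_cyclic_arc[OF fG(1)] fG by simp
        have "v \<in> cyclic_verts G" unfolding cyclic_verts_eq_heads using fG by blast
        from weight_advance[OF inv(3)[OF \<alpha>] this refl lv pend] pend lv inv(1)[OF \<alpha>]
        show ?thesis using f(4) \<open>\<alpha>' = \<alpha>\<close> \<open>u = a\<close> by auto
      next
        fix \<beta> assume \<beta>: "crossing E b \<beta> v" "length p = length \<alpha>' + length \<beta>"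
        obtain x' y' where "pending b v (length \<beta>) x' y'" using inv(2)[OF \<beta>(1)] by blast
        from pending_compose[OF inv(3)[OF \<alpha>] inv(4)[OF \<alpha>] inv(4)[OF \<beta>(1)] inv(1)[OF \<alpha>] inv(1)[OF \<beta>(1)] p(1) this]
        have "\<exists>x y. pending u v (length p) x y" using \<beta>(2) \<open>\<alpha>' = \<alpha>\<close> \<open>u = a\<close> by simp
        moreover have "lev v < lev u" "lev a - lev b < lev u - lev v"
          using inv(1)[OF \<alpha>] inv(1)[OF \<beta>(1)] \<open>u = a\<close> by auto
        ultimately show ?thesis using weight_compose by blast
      qed
    qed
    from invariant_push[OF E(1) F(1) \<alpha> this] F(1) show ?thesis by blast
  next
    case 0
    then obtain x' where Suc: "x = Suc x'" using p(2) by (cases x) auto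
    obtain F where F: "graph_step E F" "\<forall>u p v. crossing F u p v \<longrightarrow>
      crossing E u p v \<and> hd \<alpha> \<notin> set p \<or>
      (\<exists>\<alpha>'. crossing E a \<alpha>' v \<and> hd \<alpha>' = hd \<alpha> \<and>
        ((\<exists>f\<in>cyclic_arcs E. head E f = a \<and> tail E f = u \<and> length p = Suc (length \<alpha>')) \<or>
         (\<exists>\<beta>. crossing E u \<beta> a \<and> length p = length \<alpha>' + length \<beta>)))"
      using push_start[OF E.fin_digraph con arcs(1)] inv(3)[OF \<alpha>] unfolding ab Z(2) by blast
    have "crossing E u p v \<and> p \<noteq> \<alpha> \<or>
      lev v < lev u \<and> (\<exists>x y. pending u v (length p) x y) \<and>
      (weight u v (length p), weight a b (length \<alpha>)) \<in> wt_less" if pF: "crossing F u p v" for u p v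
    proof (cases "crossing E u p v \<and> hd \<alpha> \<notin> set p")
      case True
      then show ?thesis using ne by auto
    next
      case False
      then obtain \<alpha>' where \<alpha>': "crossing E a \<alpha>' v" "hd \<alpha>' = hd \<alpha>" and
        cases: "(\<exists>f\<in>cyclic_arcs E. head E f = a \<and> tail E f = u \<and> length p = Suc (length \<alpha>')) \<or>
         (\<exists>\<beta>. crossing E u \<beta> a \<and> length p = length \<alpha>' + length \<beta>)"
        using F(2) pF by blast
      have "\<alpha>' = \<alpha>" using E.separated_hd[OF E(2) \<alpha>'(1) \<alpha> \<alpha>'(2)] .
      then have "v = b" using E.crossing_ends(2)[OF \<alpha>] E.crossing_ends(2)[OF \<alpha>'(1)] by simp
      from cases show ?thesis
      proof (elim disjE bexE exE conjE)
        fix f assume f: "f \<in> cyclic_arcs E" "head E f = a" "tail E f = u" "length p = Suc (length \<alpha>')"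
        have fG: "f \<in> cyclic_arcs G" "head G f = a" "tail G f = u" using f Z by auto
        have pend: "pending u b (Suc (length \<alpha>)) x' y"
          using pending_advance_start[OF fG(1,2), of b "length \<alpha>" x' y] p(1) Suc fG(3) by simp
        have lv: "lev u = lev a" using lev_cyclic_arc[OF fG(1)] fG by simp
        have "u \<in> cyclic_verts G" unfolding cyclic_verts_eq_tails using fG by blast
        from weight_advance[OF this inv(4)[OF \<alpha>] lv refl pend] pend lv inv(1)[OF \<alpha>]
        show ?thesis using f(4) \<open>\<alpha>' = \<alpha>\<close> \<open>v = b\<close> by auto
      next
        fix \<beta> assume \<beta>: "crossing E u \<beta> a" "length p = length \<alpha>' + length \<beta>"
        obtain x' y' where "pending u a (length \<beta>) x' y'" using inv(2)[OF \<beta>(1)] by blast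
        from pending_compose[OF inv(3)[OF \<beta>(1)] inv(3)[OF \<alpha>] inv(4)[OF \<alpha>] inv(1)[OF \<beta>(1)] inv(1)[OF \<alpha>] this p(1)]
        have "\<exists>x y. pending u v (length p) x y" using \<beta>(2) \<open>\<alpha>' = \<alpha>\<close> \<open>v = b\<close> by (simp add: add.commute)
        moreover have "lev v < lev u" "lev a - lev b < lev u - lev v"
          using inv(1)[OF \<alpha>] inv(1)[OF \<beta>(1)] \<open>v = b\<close> by auto
        ultimately show ?thesis using weight_compose by blast
      qed
    qed
    from invariant_push[OF E(1) F(1) \<alpha> this] F(1) show ?thesis by blast
  qed
qed

lemma invariant_G: "invariant G"
proof -
  have "\<exists>x y. pending u v (length p) x y" if p: "crossing G u p v" for u p v
  proof (rule pending_exists)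
    show "u \<in> cyclic_verts G" "v \<in> cyclic_verts G" using p by (auto simp: crossing_def)
    have "length p + 8 * N \<le> N * (length p + 8)" using N_pos by (simp add: algebra_simps)
    also have "\<dots> \<le> N * c * 1" unfolding mult_1_right using c[of p] p by (intro mult_le_mono2) (auto simp: crossings_def)
    also have "N * c * 1 \<le> N * c * (lev u - lev v)" using lev_crossing[OF p] by (intro mult_le_mono2) linarith
    finally show "length p + 8 * N \<le> N * c * (lev u - lev v)" .
  qed
  then show ?thesis
    using lev_crossing connected_G fin_digraph by (auto simp: invariant_def)
qed

text \<open>
  Separating does not change the weights, and may hence be repeated before each move.  Well-founded
  recursion takes place on the multiset of weights.
\<close>
lemma settle:
  assumes "invariant E"
  shows "\<exists>F. graph_steps E F \<and> invariant F \<and> separated F \<and>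
    (\<forall>u p v. crossing F u p v \<longrightarrow> pending u v (length p) 0 0)"
  using assms
proof (induction "weights E" arbitrary: E rule: wf_induct_rule[OF wf_mult[of wt_less]])
  case 1
  show ?case by auto
next
  case (2 E)
  have "fin_digraph E" "Digraph_Component.connected E" using 2(2) by (auto simp: invariant_def)
  then obtain S where S: "graph_steps E S" "separated S" "same_crossings S E"
    using separation by blast
  note inv = invariant_same_crossings[OF 2(2) S(1,3)]
  show ?case
  proof (cases "\<forall>u p v. crossing S u p v \<longrightarrow> pending u v (length p) 0 0")
    case True
    then show ?thesis using S inv(1) by blast
  next
    case False
    then obtain a \<alpha> b where \<alpha>: "crossing S a \<alpha> b" "\<not> pending a b (length \<alpha>) 0 0" by blast
    then obtain x y where xy: "pending a b (length \<alpha>) x y" using inv(1) unfolding invariant_def by blast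
    with \<alpha>(2) have "x + y > 0" by (cases "x = 0"; cases "y = 0") auto
    from advance[OF inv(1) S(2) \<alpha>(1) xy this] obtain F
      where F: "graph_step S F" "invariant F" "(weights F, weights S) \<in> mult wt_less" by blast
    then obtain H where "graph_steps F H" "invariant H" "separated H"
      "\<forall>u p v. crossing H u p v \<longrightarrow> pending u v (length p) 0 0"
      using 2(1)[of F] inv(2) by auto
    then show ?thesis
      using graph_steps_trans[OF graph_steps_trans[OF S(1) graph_step_steps[OF F(1)]]] by blast
  qed
qed

end

section \<open>Settled graphs are in normal form\<close>

context phased_graph begin

lemma same_cycle_objects:
  assumes "same_cycles G F"
  shows "cycles F = cycles G" "C \<in> cycles G \<Longrightarrow> cycle_verts F C = cycle_verts G C"
proof -
  show "cycles F = cycles G" using assms by (simp add: cycles_def same_cycles_def)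
  assume "C \<in> cycles G"
  then obtain p where p: "cycle p" "C = rotations p" by (rule cycles_obtain)
  then have "set p \<subseteq> cyclic_arcs G" by (auto simp: cyclic_arcs_def)
  then have "tail F ` set p = tail G ` set p"
    using assms by (intro image_cong) (auto simp: same_cycles_def)
  then show "cycle_verts F C = cycle_verts G C" by (simp add: p cycle_verts_rotations)
qed

lemma settled_pos:
  assumes "invariant F" "crossing F u p v" "pending u v (length p) 0 0"
  shows "pos u = 0" "pos v = 0"
proof -
  have uv: "u \<in> cyclic_verts G" "v \<in> cyclic_verts G" using invariant_ends[OF assms(1,2)] by auto
  show "pos u = 0" using assms(3) cyclic_vert_nth(1)[OF uv(1)] by (auto simp: pending_def cong_def)
  show "pos v = 0" using assms(3) cyclic_vert_nth(1)[OF uv(2)] by (auto simp: pending_def cong_def)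
qed

text \<open>As \<open>N\<close> is divisible by the product of the two cycle lengths, only the remainder \<open>t\<close> survives.\<close>
lemma settled_length:
  assumes uv: "u \<in> cyclic_verts G" "v \<in> cyclic_verts G" and l: "pending u v l 0 0"
  obtains t where "t < gcd (len u) (len v)" "l + 5 * N = N * c * (lev u - lev v) + t"
    "[l = t] (mod gcd (len u) (len v))" "[l = t] (mod len u * len v)"
proof -
  obtain t where t: "t < gcd (len u) (len v)" "l + 5 * N = N * c * (lev u - lev v) + t"
    using l by (auto simp: pending_def)
  have *: "[l = t] (mod M)" if "M dvd N" for M
  proof -
    have "[l + 5 * N = l + 0] (mod M)" using that by (intro cong_add) (simp_all add: cong_0_iff)
    moreover have "[N * c * (lev u - lev v) + t = 0 + t] (mod M)"
      using that by (intro cong_add) (simp_all add: cong_0_iff)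
    ultimately show ?thesis using t(2) by (simp add: cong_def)
  qed
  have "gcd (len u) (len v) dvd len u * len v" by simp
  then have "gcd (len u) (len v) dvd N" using N_dvd[OF uv] dvd_trans by blast
  with t * N_dvd[OF uv] that show thesis by blast
qed

text \<open>
  The distinguished vertices are those of position 0.  For a pair \<open>(A, A)\<close> the only trails are the
  arcs of \<open>A\<close>, of length 1: a crossing from \<open>A\<close> to \<open>A\<close> would start and end at the same vertex,
  against the decrease of levels.
\<close>
lemma settled_normal_form:
  assumes F: "invariant F" "separated F"
    and settled: "\<And>u p v. crossing F u p v \<Longrightarrow> pending u v (length p) 0 0"
  shows "normal_form F"
proof -
  interpret F: fin_digraph F using F(1) by (rule invariant_fin)
  have same: "same_cycles G F" using F(1) by (simp add: invariant_def)
  note Z = invariant_cyclic[OF F(1)]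
  note cyc_F = same_cycle_objects[OF same]
  have disj: "disjoint_cycles F"
    unfolding disjoint_cycles_def
  proof (intro allI impI)
    fix v p q assume "cycle_at F v p \<and> cycle_at F v q"
    then have pq: "F.cycle p" "F.cycle q" "tail F (hd p) = v" "tail F (hd q) = v"
      by (auto simp: F.cycle_at_iff)
    then have pqG: "cycle p" "cycle q" using same by (auto simp: same_cycles_def)
    have "p \<noteq> []" "q \<noteq> []" using pqG by (auto simp: cycle_def)
    then have "hd p \<in> cyclic_arcs G" "hd q \<in> cyclic_arcs G"
      using pqG by (auto simp: cyclic_arcs_def)
    then have "cycle_at G v p" "cycle_at G v q"
      using pq pqG Z(3) by (auto simp: cycle_at_iff)
    then show "p = q" using disjoint unfolding disjoint_cycles_def by blast
  qed
  have trail_cases: "(\<exists>f\<in>cyclic_arcs G. p = [f]) \<or> crossing F (trail_source F p) p (trail_range F p)"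
    if "cycle_trail F p" for p
    using that F.cycle_trail_iff[of p] F.crossings_iff[of p] Z(1) by blast
  have interiors: "interior_verts F p \<inter> interior_verts F q = {}"
    if "cycle_trail F p" "cycle_trail F q" "p \<noteq> q" for p q
  proof (cases "p \<in> crossings F \<and> q \<in> crossings F")
    case True
    then show ?thesis using F.separated_interiors[OF F(2), of p q] that(3) by blast
  next
    case False
    then have "(\<exists>f\<in>cyclic_arcs F. p = [f]) \<or> (\<exists>f\<in>cyclic_arcs F. q = [f])"
      using that(1,2) F.cycle_trail_iff[of p] F.cycle_trail_iff[of q] by blast
    then have "interior_verts F p = {} \<or> interior_verts F q = {}"
      using F.interior_verts_cyclic_arc by metis
    then show ?thesis by blast
  qed
  define d where "d C = (SOME v. v \<in> cycle_verts G C \<and> pos v = 0)" for C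
  have d: "d C \<in> cycle_verts G C" "pos (d C) = 0" if C: "C \<in> cycles G" for C
  proof -
    have "\<exists>v. v \<in> cycle_verts G C \<and> pos v = 0" using pos_0_exists[OF C] by blast
    then have "d C \<in> cycle_verts G C \<and> pos (d C) = 0" unfolding d_def by (rule someI_ex)
    then show "d C \<in> cycle_verts G C" "pos (d C) = 0" by simp_all
  qed
  have cv: "cycle_verts G C \<subseteq> cyclic_verts G" if "C \<in> cycles G" for C
    using that by (auto simp: cyclic_verts_def)
  have is_d: "v = d C" if C: "C \<in> cycles G" "v \<in> cycle_verts G C" "pos v = 0" for v C
  proof (rule pos_inj)
    show "v \<in> cyclic_verts G" using C(2) cv[OF C(1)] by blast
    show "d C \<in> cyclic_verts G" using d(1)[OF C(1)] cv[OF C(1)] by blast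
    show "cyc v = cyc (d C)" using cyc_eqI[OF C(1,2)] cyc_eqI[OF C(1) d(1)[OF C(1)]] by simp
    show "pos v = pos (d C)" using d(2)[OF C(1)] C(3) by simp
  qed
  have cross: "trail_source F p = d A \<and> trail_range F p = d B \<and> A \<noteq> B"
    if A: "A \<in> cycles G" and B: "B \<in> cycles G" and p: "trail_from_to F A p B"
      "crossing F (trail_source F p) p (trail_range F p)" for A B p
  proof -
    have "trail_source F p \<in> cycle_verts G A" "trail_range F p \<in> cycle_verts G B"
      using p(1) A B cyc_F(2) by (auto simp: trail_from_to_def)
    moreover note settled_pos[OF F(1) p(2) settled[OF p(2)]]
    ultimately have "trail_source F p = d A" "trail_range F p = d B" using is_d A B by blast+
    moreover have "lev (trail_range F p) < lev (trail_source F p)"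
      using F(1) p(2) by (simp add: invariant_def)
    ultimately show ?thesis by auto
  qed
  have arc: "A = B" if A: "A \<in> cycles G" and B: "B \<in> cycles G" and p: "trail_from_to F A [f] B"
      "f \<in> cyclic_arcs G" for A B f
  proof -
    have "tail G f \<in> cycle_verts G A" "head G f \<in> cycle_verts G B"
      using p A B cyc_F(2) Z(3,4)[of f] by (auto simp: trail_from_to_def trail_source_def trail_range_def)
    then show ?thesis using cyc_eqI[OF A] cyc_eqI[OF B] cyclic_arc_next(1)[OF p(2)] by metis
  qed
  have ct: "cycle_trail F p" if "trail_from_to F A p B" for A p B
    using that by (simp add: trail_from_to_def)
  have ends: "trail_source F p = d A \<and> trail_range F p = d B"
    if "A \<in> cycles G" "B \<in> cycles G" "A \<noteq> B" "trail_from_to F A p B" for A B p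
    using trail_cases[OF ct[OF that(4)]] arc[OF that(1,2)] cross[OF that(1,2,4)] that(3,4) by blast
  have qnf: "quasi_normal_form F"
    unfolding quasi_normal_form_def cyc_F(1)
  proof (intro conjI exI[of _ d] allI impI ballI)
    show "fin_digraph F" "Digraph_Component.connected F" using F(1) by (simp_all add: invariant_def)
    show "disjoint_cycles F" by (rule disj)
    show "interior_verts F p \<inter> interior_verts F q = {}"
      if "cycle_trail F p \<and> cycle_trail F q \<and> p \<noteq> q" for p q using that interiors by blast
    show "d C \<in> cycle_verts F C" if "C \<in> cycles G" for C using d that cyc_F(2) by simp
    fix A B p assume "A \<in> cycles G" "B \<in> cycles G" "A \<noteq> B" "trail_from_to F A p B"
    from ends[OF this] show "trail_source F p = d A" "trail_range F p = d B" by simp_all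
  qed
  have good: "good_pair F A B" if A: "A \<in> cycles G" and B: "B \<in> cycles G" for A B
  proof (cases "A = B")
    case True
    have one: "length p = 1" if "trail_from_to F A p B" for p
      using trail_cases[OF ct[OF that]] cross[OF A B that] True by auto
    have "[1 = t] (mod n * n)" if "t < n" "[1 = t] (mod n)" for n t :: nat
    proof (cases "n = 1")
      case False
      then have "t = 1" using that by (auto simp: cong_def)
      then show ?thesis by simp
    qed simp
    then show ?thesis unfolding good_pair_def True using one True by simp
  next
    case False
    define u v where "u = d A" and "v = d B"
    have uv: "u \<in> cyclic_verts G" "v \<in> cyclic_verts G"
      using d(1)[OF A] d(1)[OF B] cv[OF A] cv[OF B] by (auto simp: u_def v_def)
    have L: "cycle_length A = len u" "cycle_length B = len v"
      using cycle_length_cyc[OF uv(1)] cycle_length_cyc[OF uv(2)]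
        cyc_eqI[OF A d(1)[OF A]] cyc_eqI[OF B d(1)[OF B]] by (simp_all add: u_def v_def)
    have pend: "pending u v (length p) 0 0" if p: "trail_from_to F A p B" for p
      using trail_cases[OF ct[OF p]] arc[OF A B] False p ends[OF A B False p] settled
      unfolding u_def v_def by metis
    show ?thesis
      unfolding good_pair_def L
    proof (intro allI impI conjI)
      fix p q assume pq: "trail_from_to F A p B \<and> trail_from_to F A q B"
      obtain t where t: "t < gcd (len u) (len v)" "length p + 5 * N = N * c * (lev u - lev v) + t"
        "[length p = t] (mod gcd (len u) (len v))" "[length p = t] (mod len u * len v)"
        using settled_length[OF uv pend] pq by blast
      obtain s where s: "s < gcd (len u) (len v)" "length q + 5 * N = N * c * (lev u - lev v) + s"
        "[length q = s] (mod gcd (len u) (len v))"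
        using settled_length[OF uv pend] pq by blast
      {
        assume "[length p = length q] (mod gcd (len u) (len v))"
        then have "t = s" using t s by (simp add: cong_def)
        then show "length p = length q" using t(2) s(2) by linarith
      next
        fix r assume "r < gcd (len u) (len v)" "[length p = r] (mod gcd (len u) (len v))"
        then have "r = t" using t by (simp add: cong_def)
        then show "[length p = r] (mod len u * len v)" using t(4) by simp
      }
    qed
  qed
  show ?thesis unfolding normal_form_def cyc_F(1) using qnf good by blast
qed

lemma normal_form_reachable: "\<exists>F. splitting_step\<^sup>*\<^sup>* G F \<and> normal_form F"
  using settle[OF invariant_G] settled_normal_form unfolding graph_steps_def by metis

end

section \<open>Arbitrary graphs\<close>

text \<open>
  The square of the product of all cycle lengths (each occurring once per vertex of the cycle) is a
  common multiple of the products of two of them, also of equal ones.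
\<close>
lemma normal_form_of_nat_graph:
  fixes G :: "(nat,nat) pre_digraph"
  assumes "fin_digraph G" "Digraph_Component.connected G" "disjoint_cycles G"
  shows "\<exists>F. splitting_step\<^sup>*\<^sup>* G F \<and> normal_form F"
proof -
  interpret disjoint_cycle_graph G
    using assms by (simp add: disjoint_cycle_graph_def disjoint_cycle_graph_axioms_def)
  have fin: "finite (cyclic_verts G)"
    using cyclic_verts_subset finite_verts by (rule finite_subset)
  define K where "K = (\<Prod>v\<in>cyclic_verts G. len v)"
  define c where "c = (\<Sum>p\<in>crossings G. length p) + 8"
  interpret phased_graph G "K * K" c
  proof
    show "Digraph_Component.connected G" by (rule assms)
    show "len u * len v dvd K * K" if "u \<in> cyclic_verts G" "v \<in> cyclic_verts G" for u v
      unfolding K_def using that fin by (intro mult_dvd_mono dvd_prodI)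
    have "len v \<noteq> 0" if "v \<in> cyclic_verts G" for v using cyclic_vert_nth(1)[OF that] by linarith
    then show "0 < K * K" by (simp add: K_def fin)
    show "length p + 8 \<le> c" if "p \<in> crossings G" for p
      using member_le_sum[OF that, of length] finite_crossings by (simp add: c_def)
  qed
  show ?thesis by (rule normal_form_reachable)
qed

lemma disjoint_cycles_app_iso:
  assumes wf: "wf_digraph E" and hom: "pre_digraph.digraph_isomorphism E hom" and disj: "disjoint_cycles E"
  shows "disjoint_cycles (app_iso hom E)"
proof -
  interpret E: wf_digraph E by (rule wf)
  interpret H: wf_digraph "app_iso hom E" using hom by (rule E.wf_digraphI_app_iso)
  have inj: "inj_on (iso_arcs hom) (arcs E)" "inj_on (iso_verts hom) (verts E)"
    using hom unfolding pre_digraph.digraph_isomorphism_def by auto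
  have pull: "\<exists>q. E.cycle q \<and> p = map (iso_arcs hom) q" if p: "H.cycle p" for p
  proof -
    have "set p \<subseteq> iso_arcs hom ` arcs E" "p \<noteq> []" using p unfolding H.cycle_iff_rotate1 by auto
    moreover from this(1) have "p \<in> lists (iso_arcs hom ` arcs E)" by (simp add: in_lists_conv_set subset_iff)
    ultimately obtain q where q: "set q \<subseteq> arcs E" "p = map (iso_arcs hom) q"
      unfolding lists_image by (auto simp: in_lists_conv_set subset_iff)
    have t: "map (tail (app_iso hom E)) p = map (iso_verts hom) (map (tail E) q)"
      "map (head (app_iso hom E)) p = map (iso_verts hom) (map (head E) q)"
      using q E.iso_verts_tail[OF hom] E.iso_verts_head[OF hom] by auto
    have "map (iso_verts hom) (map (head E) q) = map (iso_verts hom) (rotate1 (map (tail E) q))"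
      using p unfolding H.cycle_iff_rotate1 t by (simp only: rotate1_map)
    then have "map (head E) q = rotate1 (map (tail E) q)"
    proof (rule map_inj_on)
      have "head E ` set q \<union> tail E ` set q \<subseteq> verts E" using q by auto
      then show "inj_on (iso_verts hom) (set (map (head E) q) \<union> set (rotate1 (map (tail E) q)))"
        using inj_on_subset[OF inj(2)] by simp
    qed
    moreover have "distinct (map (tail E) q)"
      using p distinct_map[of "iso_verts hom" "map (tail E) q"] unfolding H.cycle_iff_rotate1 t by blast
    ultimately have "E.cycle q" using q \<open>p \<noteq> []\<close> by (simp add: E.cycle_iff_rotate1)
    with q show ?thesis by blast
  qed
  show ?thesis
    unfolding disjoint_cycles_def
  proof (intro allI impI)
    fix v p q assume "cycle_at (app_iso hom E) v p \<and> cycle_at (app_iso hom E) v q"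
    then have pq: "H.cycle p" "H.cycle q" "tail (app_iso hom E) (hd p) = tail (app_iso hom E) (hd q)"
      by (auto simp: H.cycle_at_iff)
    obtain p' q' where p': "E.cycle p'" "p = map (iso_arcs hom) p'"
      and q': "E.cycle q'" "q = map (iso_arcs hom) q'" using pull pq by metis
    have ne: "p' \<noteq> []" "q' \<noteq> []" "set p' \<subseteq> arcs E" "set q' \<subseteq> arcs E"
      using p' q' by (auto simp: E.cycle_iff_rotate1)
    then have a: "hd p' \<in> arcs E" "hd q' \<in> arcs E" by auto
    have "iso_verts hom (tail E (hd p')) = iso_verts hom (tail E (hd q'))"
      using pq(3) ne a E.iso_verts_tail[OF hom] by (simp add: p' q' hd_map)
    then have "tail E (hd p') = tail E (hd q')" using a inj(2) by (auto dest: inj_onD)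
    then have "cycle_at E (tail E (hd p')) p'" "cycle_at E (tail E (hd p')) q'"
      using p' q' by (simp_all add: E.cycle_at_iff)
    then have "p' = q'" using disj unfolding disjoint_cycles_def by blast
    then show "p = q" by (simp add: p' q')
  qed
qed

lemma nat_copy:
  fixes E :: "('a,'b) pre_digraph"
  assumes "fin_digraph E"
  obtains hom :: "('a,'b,nat,nat) digraph_isomorphism" where "pre_digraph.digraph_isomorphism E hom"
proof -
  interpret fin_digraph E by (rule assms)
  obtain f :: "'a \<Rightarrow> nat" where f: "inj_on f (verts E)"
    using finite_imp_inj_to_nat_seg[OF finite_verts] by blast
  obtain g :: "'b \<Rightarrow> nat" where g: "inj_on g (arcs E)"
    using finite_imp_inj_to_nat_seg[OF finite_arcs] by blast
  define hom where "hom = \<lparr>iso_verts = f, iso_arcs = g,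
    iso_head = (\<lambda>n. f (head E (the_inv_into (arcs E) g n))),
    iso_tail = (\<lambda>n. f (tail E (the_inv_into (arcs E) g n)))\<rparr>"
  have "pre_digraph.digraph_isomorphism E hom"
    unfolding pre_digraph.digraph_isomorphism_def
    using f g wf_digraph by (simp add: hom_def the_inv_into_f_f)
  then show thesis by (rule that)
qed

theorem theorem3p13:
  fixes E :: "('a,'b) pre_digraph"
  assumes "fin_digraph E" and "Digraph_Component.connected E" and "disjoint_cycles E"
  shows "\<exists>F :: (nat,nat) pre_digraph. transforms_by_splittings E F \<and> normal_form F"
proof -
  interpret fin_digraph E by (rule assms)
  obtain hom :: "('a,'b,nat,nat) digraph_isomorphism" where hom: "digraph_isomorphism hom"
    using nat_copy[OF assms(1)] .
  define G where "G = app_iso hom E"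
  have "fin_digraph G" "Digraph_Component.connected G" "disjoint_cycles G"
    unfolding G_def
    using fin_digraphI_app_iso[OF hom] connectedI_app_iso[OF assms(2) hom]
      disjoint_cycles_app_iso[OF wf_digraph hom assms(3)] .
  then obtain F where "splitting_step\<^sup>*\<^sup>* G F" "normal_form F"
    using normal_form_of_nat_graph by blast
  moreover have "digraph_iso E G" unfolding digraph_iso_def G_def using hom by blast
  ultimately show ?thesis unfolding transforms_by_splittings_def by blast
qed

end
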